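(* Let $0\le\underline c<\bar c$ and $S=[\underline c,\bar c]$. Let $\{C_{x,c}\in\Pi^S_{x,c}:(x,c)\in[0,\infty)\times[\underline c,\bar c]\}$ be a family of admissible strategies. If $W(x,c):=J(x;C_{x,c})$ is a viscosity supersolution of $\max\{\mathcal L^c(u)(x,c),\partial_cu(x,c)\}=0$ in $(0,\infty)\times[\underline c,\bar c)$ with $W(0,c)=0$ and $\lim_{x\to\infty}W(x,c)=\bar c/q$, then $W=V^S$. Moreover, if for each $k\ge1$ there is a family $\{C^k_{x,c}\in\Pi^S_{x,c}\}$ such that $W(x,c):=\lim_{k\to\infty}J(x;C^k_{x,c})$ exists and is a viscosity supersolution of the same equation in $(0,\infty)\times[\underline c,\bar c)$ with $W(0,c)=0$ and $\lim_{x\to\infty}W(x,c)=\bar c/q$, then $W=V^S$.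
   Context: Fix constants $\mu>0$, $\sigma>0$, $q>0$. Let $W$ be a standard Brownian motion and $X_t=x+\mu t+\sigma W_t$, with $(\mathcal F_t)_{t\ge0}$ the completed filtration generated by $X$. For a set $S\subset[0,\infty)$ with $\bar c=\max S<\infty$, $x\ge0$ and $c\in S$, let $\Pi^S_{x,c}$ be the set of processes $C=(C_t)_{t\ge0}$ that are non-decreasing, right-continuous, $(\mathcal F_t)$-adapted, with $C_t\in S$ and $C_t\ge c$ for all $t$. The controlled surplus is $X^C_t=X_t-\int_0^tC_s\,ds$, the ruin time is $\tau=\inf\{t\ge0:X^C_t<0\}$, $J(x;C)=\mathbb E[\int_0^\tau e^{-qs}C_s\,ds]$, and $V^S(x,c)=\sup_{C\in\Pi^S_{x,c}}J(x;C)$. For $c\ge0$, $\mathcal L^c(W)=\frac{\sigma^2}{2}\partial_{xx}W+(\mu-c)\partial_xW-qW+c$. A function $f:[0,\infty)\times[\underline c,\bar c)\to\mathbb R$ is (2,1)-differentiable if $f$ is continuously differentiable and $\partial_xf(\cdot,c)$ is continuously differentiable. A locally Lipschitz $\bar u$ is a viscosity supersolution at $(x,c)$ if every (2,1)-differentiable $\varphi$ with $\varphi(x,c)=\bar u(x,c)$ such that $\bar u-\varphi$ attains its minimum at $(x,c)$ satisfies $\max\{\mathcal L^c(\varphi)(x,c),\partial_c\varphi(x,c)\}\le0$. *)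

theory Defs
  imports "HOL-Probability.Probability"
begin

definition std_BM :: "'a measure \<Rightarrow> (real \<Rightarrow> 'a \<Rightarrow> real) \<Rightarrow> bool" where
  "std_BM M B \<longleftrightarrow> prob_space M \<and>
     (\<forall>t. B t \<in> borel_measurable M) \<and>
     (\<forall>\<omega>\<in>space M. B 0 \<omega> = 0 \<and> continuous_on {0..} (\<lambda>t. B t \<omega>)) \<and>
     (\<forall>s t. 0 \<le> s \<and> s < t \<longrightarrow>
        distributed M lborel (\<lambda>\<omega>. B t \<omega> - B s \<omega>) (normal_density 0 (sqrt (t - s)))) \<and>
     (\<forall>(ts::nat \<Rightarrow> real) n. 0 \<le> ts 0 \<and> strict_mono ts \<longrightarrow>
        prob_space.indep_vars M (\<lambda>_. borel) (\<lambda>i \<omega>. B (ts (Suc i)) \<omega> - B (ts i) \<omega>) {..<n})"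

definition Xproc :: "real \<Rightarrow> real \<Rightarrow> (real \<Rightarrow> 'a \<Rightarrow> real) \<Rightarrow> real \<Rightarrow> real \<Rightarrow> 'a \<Rightarrow> real" where
  "Xproc mu sig B x t \<omega> = x + mu * t + sig * B t \<omega>"

definition filt :: "'a measure \<Rightarrow> (real \<Rightarrow> 'a \<Rightarrow> real) \<Rightarrow> real \<Rightarrow> 'a measure" where
  "filt M X t = sigma (space M)
     ({X s -` A \<inter> space M | s A. 0 \<le> s \<and> s \<le> t \<and> A \<in> sets borel} \<union>
      {N. N \<subseteq> space M \<and> (\<exists>A\<in>null_sets M. N \<subseteq> A)})"

definition admissible :: "'a measure \<Rightarrow> real \<Rightarrow> real \<Rightarrow> (real \<Rightarrow> 'a \<Rightarrow> real) \<Rightarrow> real set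
    \<Rightarrow> real \<Rightarrow> real \<Rightarrow> (real \<Rightarrow> 'a \<Rightarrow> real) set" where
  "admissible M mu sig B S x c = {C.
     (\<forall>\<omega>\<in>space M. mono_on {0..} (\<lambda>t. C t \<omega>) \<and>
        (\<forall>t\<ge>0. continuous (at_right t) (\<lambda>s. C s \<omega>)) \<and>
        (\<forall>t\<ge>0. C t \<omega> \<in> S \<and> c \<le> C t \<omega>)) \<and>
     (\<forall>t\<ge>0. C t \<in> borel_measurable (filt M (Xproc mu sig B x) t))}"

definition surplus :: "real \<Rightarrow> real \<Rightarrow> (real \<Rightarrow> 'a \<Rightarrow> real) \<Rightarrow> real \<Rightarrow> (real \<Rightarrow> 'a \<Rightarrow> real)
    \<Rightarrow> real \<Rightarrow> 'a \<Rightarrow> real" where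
  "surplus mu sig B x C t \<omega> = Xproc mu sig B x t \<omega> - integral {0..t} (\<lambda>s. C s \<omega>)"

text \<open>Ruin time (inf of the empty set is +oo).\<close>
definition ruin_time :: "real \<Rightarrow> real \<Rightarrow> (real \<Rightarrow> 'a \<Rightarrow> real) \<Rightarrow> real \<Rightarrow> (real \<Rightarrow> 'a \<Rightarrow> real)
    \<Rightarrow> 'a \<Rightarrow> ereal" where
  "ruin_time mu sig B x C \<omega> = Inf {ereal t | t. 0 \<le> t \<and> surplus mu sig B x C t \<omega> < 0}"

definition Jval :: "'a measure \<Rightarrow> real \<Rightarrow> real \<Rightarrow> real \<Rightarrow> (real \<Rightarrow> 'a \<Rightarrow> real) \<Rightarrow> real
    \<Rightarrow> (real \<Rightarrow> 'a \<Rightarrow> real) \<Rightarrow> real" where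
  "Jval M mu sig q B x C = enn2real (\<integral>\<^sup>+ \<omega>.
     (\<integral>\<^sup>+ s. indicator {s. 0 \<le> s \<and> ereal s < ruin_time mu sig B x C \<omega>} s
              * ennreal (exp (- q * s) * C s \<omega>) \<partial>lborel) \<partial>M)"

definition Vval :: "'a measure \<Rightarrow> real \<Rightarrow> real \<Rightarrow> real \<Rightarrow> (real \<Rightarrow> 'a \<Rightarrow> real) \<Rightarrow> real set
    \<Rightarrow> real \<Rightarrow> real \<Rightarrow> real" where
  "Vval M mu sig q B S x c = (SUP C \<in> admissible M mu sig B S x c. Jval M mu sig q B x C)"

text \<open>L^c applied to a function with value u, first x-derivative ux, second x-derivative uxx.\<close>
definition gen_op :: "real \<Rightarrow> real \<Rightarrow> real \<Rightarrow> real \<Rightarrow> real \<Rightarrow> real \<Rightarrow> real \<Rightarrow> real" where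
  "gen_op mu sig q c u ux uxx = sig\<^sup>2 / 2 * uxx + (mu - c) * ux - q * u + c"

definition diff21 :: "real \<Rightarrow> real \<Rightarrow> (real \<times> real \<Rightarrow> real) \<Rightarrow> (real \<times> real \<Rightarrow> real)
    \<Rightarrow> (real \<times> real \<Rightarrow> real) \<Rightarrow> (real \<times> real \<Rightarrow> real) \<Rightarrow> bool" where
  "diff21 clo chi phi phix phic phixx \<longleftrightarrow>
     (let D = {0..} \<times> {clo..<chi} in
       (\<forall>p\<in>D. (phi has_derivative (\<lambda>(h,k). phix p * h + phic p * k)) (at p within D)) \<and>
       continuous_on D phix \<and> continuous_on D phic \<and>
       (\<forall>c\<in>{clo..<chi}.
          (\<forall>x\<ge>0. ((\<lambda>y. phix (y, c)) has_real_derivative phixx (x, c)) (at x within {0..})) \<and>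
          continuous_on {0..} (\<lambda>y. phixx (y, c))))"

definition loc_lipschitz_on :: "(real \<times> real) set \<Rightarrow> (real \<times> real \<Rightarrow> real) \<Rightarrow> bool" where
  "loc_lipschitz_on D u \<longleftrightarrow> (\<forall>p\<in>D. \<exists>e>0. \<exists>L. \<forall>a\<in>D \<inter> ball p e. \<forall>b\<in>D \<inter> ball p e.
      \<bar>u a - u b\<bar> \<le> L * dist a b)"

definition visc_super :: "real \<Rightarrow> real \<Rightarrow> real \<Rightarrow> real \<Rightarrow> real \<Rightarrow> (real \<times> real \<Rightarrow> real) \<Rightarrow> bool" where
  "visc_super mu sig q clo chi u \<longleftrightarrow>
     loc_lipschitz_on ({0..} \<times> {clo..<chi}) u \<and>
     (\<forall>x c. 0 < x \<and> clo \<le> c \<and> c < chi \<longrightarrow>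
        (\<forall>phi phix phic phixx. diff21 clo chi phi phix phic phixx \<and> phi (x, c) = u (x, c) \<and>
           (\<forall>p\<in>{0..} \<times> {clo..<chi}. u p - phi p \<ge> u (x, c) - phi (x, c)) \<longrightarrow>
           max (gen_op mu sig q c (phi (x, c)) (phix (x, c)) (phixx (x, c))) (phic (x, c)) \<le> 0))"

end

theory Submission
  imports Defs "HOL-Real_Asymp.Real_Asymp"
begin

text \<open>
  Only \<open>Jval x C \<le> W (x, c)\<close> for admissible \<open>C\<close> and \<open>c < chi\<close> needs work. Tests against separable
  functions show that \<open>W\<close> is nonincreasing in \<open>c\<close> and that, for fixed \<open>c\<close>, it dominates on an interval
  every classical subsolution of the linear equation which it dominates at the end points. For the
  solutions \<open>c / q + A * exp (\<theta>\<^sub>1 * x) + B * exp (\<theta>\<^sub>2 * x)\<close> this is a concavity property, so through every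
  point of the graph there passes a solution lying above \<open>W\<close> on the whole half line. Such exponential
  solutions are integrated exactly against the Gaussian transition, which yields a one-step
  supermartingale inequality without stochastic calculus.

  An arbitrary strategy is compared with the strategy frozen on a time grid of step \<open>t\<close>, with ruin
  observed on the grid only. Shifting \<open>W\<close>
    by \<open>eps\<close> in the space variable makes the error of ignoring ruin
  within one step of order \<open>exp (- eps / sqrt t)\<close>, hence negligible after summing over all steps. Then
  first \<open>t\<close> and afterwards \<open>eps\<close> tend to 0.
\<close>

section \<open>Viscosity supersolutions\<close>

lemma loc_lipschitz_on_imp_continuous_on:
  assumes "loc_lipschitz_on D u"
  shows "continuous_on D u"
  unfolding continuous_on_def
proof
  fix p assume p: "p \<in> D"
  obtain r L where r: "0 < r"
    and L: "\<And>a b. a \<in> D \<inter> ball p r \<Longrightarrow> b \<in> D \<inter> ball p r \<Longrightarrow> \<bar>u a - u b\<bar> \<le> L * dist a b"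
    using assms p unfolding loc_lipschitz_on_def by blast
  have "(max L 0)-lipschitz_on (D \<inter> ball p r) u"
  proof (rule lipschitz_onI)
    show "dist (u a) (u b) \<le> max L 0 * dist a b" if "a \<in> D \<inter> ball p r" "b \<in> D \<inter> ball p r" for a b
      using order_trans[OF L[OF that] mult_right_mono[of L "max L 0" "dist a b"]]
      by (simp add: dist_real_def)
  qed simp
  then have "(u \<longlongrightarrow> u p) (at p within D \<inter> ball p r)"
    using p r by (auto dest: lipschitz_on_continuous_on simp: continuous_on_def)
  moreover have "at p within D \<inter> ball p r = at p within D"
    using r by (intro at_within_nhd[of p "ball p r"]) auto
  ultimately show "(u \<longlongrightarrow> u p) (at p within D)" by simp
qed

lemma diff21_separable:
  assumes f: "\<And>x. (f has_real_derivative f' x) (at x)"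
    and f': "\<And>x. (f' has_real_derivative f'' x) (at x)"
    and f'': "continuous_on UNIV f''"
    and g: "\<And>c. (g has_real_derivative g' c) (at c)"
    and g': "continuous_on UNIV g'"
  shows "diff21 clo chi (\<lambda>(x, c). f x + g c) (\<lambda>(x, c). f' x) (\<lambda>(x, c). g' c) (\<lambda>(x, c). f'' x)"
  unfolding diff21_def Let_def
proof (intro conjI ballI allI impI)
  let ?D = "{0..} \<times> {clo..<chi}"
  fix p :: "real \<times> real"
  have "((\<lambda>p. f (fst p)) has_derivative (\<lambda>h. f' (fst p) * fst h)) (at p within ?D)"
    by (rule has_derivative_compose[OF has_derivative_fst[OF has_derivative_ident]
          f[unfolded has_field_derivative_def]])
  moreover have "((\<lambda>p. g (snd p)) has_derivative (\<lambda>h. g' (snd p) * snd h)) (at p within ?D)"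
    by (rule has_derivative_compose[OF has_derivative_snd[OF has_derivative_ident]
          g[unfolded has_field_derivative_def]])
  ultimately show "((\<lambda>(x, c). f x + g c) has_derivative
     (\<lambda>(h, k). (case p of (x, c) \<Rightarrow> f' x) * h + (case p of (x, c) \<Rightarrow> g' c) * k)) (at p within ?D)"
    using has_derivative_add by (force simp: case_prod_unfold)
next
  have "continuous_on UNIV f'"
    using f' by (meson DERIV_continuous_on has_field_derivative_at_within)
  then show "continuous_on ({0..} \<times> {clo..<chi}) (\<lambda>(x, c). f' x)"
    by (auto simp: case_prod_unfold intro!: continuous_on_compose2[of UNIV f'] continuous_intros)
  show "continuous_on ({0..} \<times> {clo..<chi}) (\<lambda>(x, c). g' c)"
    using g'
    by (auto simp: case_prod_unfold intro!: continuous_on_compose2[of UNIV g'] continuous_intros)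
qed (use f' f'' in \<open>auto intro: has_field_derivative_at_within continuous_on_subset\<close>)

lemma second_order_Taylor_lower_bound:
  fixes f f' f'' :: "real \<Rightarrow> real"
  assumes f: "\<And>x. (f has_real_derivative f' x) (at x)"
    and f': "\<And>x. (f' has_real_derivative f'' x) (at x)"
    and f'': "isCont f'' a" and e: "0 < e"
  shows "\<forall>\<^sub>F x in nhds a. f a + f' a * (x - a) + (f'' a - e) / 2 * (x - a)\<^sup>2 \<le> f x"
proof -
  obtain d where d: "0 < d" and near: "\<And>t. \<bar>t - a\<bar> < d \<Longrightarrow> f'' a - e < f'' t"
    using f'' e unfolding continuous_at_eps_delta dist_real_def by (metis abs_diff_less_iff)
  have "f a + f' a * (x - a) + (f'' a - e) / 2 * (x - a)\<^sup>2 \<le> f x" if x: "\<bar>x - a\<bar> < d" for x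
  proof (cases "x = a")
    case False
    define D where "D = (\<lambda>m :: nat. if m = 0 then f else if m = 1 then f' else f'')"
    have "\<forall>m t. m < 2 \<and> min x a \<le> t \<and> t \<le> max x a \<longrightarrow> DERIV (D m) t :> D (Suc m) t"
      using f f' by (auto simp: D_def less_2_cases_iff)
    then obtain t where t: "if x < a then x < t \<and> t < a else a < t \<and> t < x"
      and Taylor_eq: "f x = (\<Sum>m<2. D m a / fact m * (x - a)^m) + D 2 t / fact 2 * (x - a)\<^sup>2"
      using Taylor[of 2 D f "min x a" "max x a" a x] False by (auto simp: D_def)
    have "\<bar>t - a\<bar> < d" using t x by (auto split: if_splits)
    then have "(f'' a - e) / 2 * (x - a)\<^sup>2 \<le> f'' t / 2 * (x - a)\<^sup>2"
      using near[of t] by (intro mult_right_mono) auto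
    then show ?thesis unfolding Taylor_eq by (simp add: D_def numeral_2_eq_2)
  qed simp
  then show ?thesis using d by (auto simp: eventually_nhds_metric dist_real_def)
qed

lemma quartic_penalty_dominates_outside_box:
  fixes a b Z d :: real
  assumes d: "0 < d"
  obtains N where "0 \<le> N"
    "\<And>u v. d \<le> \<bar>u\<bar> \<or> d \<le> \<bar>v\<bar> \<Longrightarrow> Z + a * u + b * u\<^sup>2 \<le> N * u^4 + N * v\<^sup>2"
proof -
  define A where "A = \<bar>a\<bar> + \<bar>b\<bar>"
  have quadratic_le: "a * u + b * u\<^sup>2 \<le> A + A * u^4" for u
  proof -
    have "2 * \<bar>u\<bar> \<le> 1 + u\<^sup>2" "2 * u\<^sup>2 \<le> 1 + u^4"
      using sum_squares_bound[of 1 "\<bar>u\<bar>"] sum_squares_bound[of 1 "u\<^sup>2"] by simp_all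
    moreover have "0 \<le> u\<^sup>2" "0 \<le> u^4" by simp_all
    ultimately have "\<bar>u\<bar> \<le> 1 + u^4" "u\<^sup>2 \<le> 1 + u^4" by linarith+
    then have "\<bar>a\<bar> * \<bar>u\<bar> \<le> \<bar>a\<bar> * (1 + u^4)" "\<bar>b\<bar> * u\<^sup>2 \<le> \<bar>b\<bar> * (1 + u^4)"
      by (auto intro!: mult_left_mono)
    moreover have "a * u \<le> \<bar>a\<bar> * \<bar>u\<bar>" "b * u\<^sup>2 \<le> \<bar>b\<bar> * u\<^sup>2"
      by (auto simp: abs_mult[symmetric] intro!: mult_right_mono)
    ultimately show ?thesis by (simp add: A_def algebra_simps)
  qed
  define Y where "Y = \<bar>Z\<bar> + A"
  have nonneg: "0 \<le> A" "0 \<le> Y" by (simp_all add: A_def Y_def)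
  show thesis
  proof (rule that[of "A + Y / d^4 + Y / d\<^sup>2"])
    show "0 \<le> A + Y / d^4 + Y / d\<^sup>2" using nonneg by simp
    fix u v :: real assume "d \<le> \<bar>u\<bar> \<or> d \<le> \<bar>v\<bar>"
    then have "d^4 \<le> u^4 \<or> d\<^sup>2 \<le> v\<^sup>2"
      using d power_mono[of d "\<bar>u\<bar>" 4] power_mono[of d "\<bar>v\<bar>" 2] by (auto simp: power_even_abs)
    then have "Y \<le> Y / d^4 * u^4 \<or> Y \<le> Y / d\<^sup>2 * v\<^sup>2"
      using d nonneg mult_left_mono[of "d^4" "u^4" "Y / d^4"] mult_left_mono[of "d\<^sup>2" "v\<^sup>2" "Y / d\<^sup>2"]
      by auto
    moreover have "0 \<le> Y / d^4 * u^4" "0 \<le> Y / d\<^sup>2 * v\<^sup>2" "0 \<le> Y / d^4 * v\<^sup>2"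
      "0 \<le> Y / d\<^sup>2 * u^4" "0 \<le> A * v\<^sup>2"
      using nonneg by simp_all
    ultimately have "Y + A * u^4 \<le> (A + Y / d^4 + Y / d\<^sup>2) * u^4 + (A + Y / d^4 + Y / d\<^sup>2) * v\<^sup>2"
      unfolding distrib_right by linarith
    then show "Z + a * u + b * u\<^sup>2 \<le> (A + Y / d^4 + Y / d\<^sup>2) * u^4 + (A + Y / d^4 + Y / d\<^sup>2) * v\<^sup>2"
      using quadratic_le[of u] abs_ge_self[of Z] unfolding Y_def by linarith
  qed
qed

lemma continuous_on_gt_near:
  fixes f :: "real \<Rightarrow> real"
  assumes "continuous_on S f" "x \<in> S" "l < f x"
  obtains r where "0 < r" "\<And>y. y \<in> S \<Longrightarrow> \<bar>y - x\<bar> < r \<Longrightarrow> l < f y"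
proof -
  obtain r where r: "0 < r" "\<And>y. y \<in> S \<Longrightarrow> \<bar>y - x\<bar> < r \<Longrightarrow> \<bar>f y - f x\<bar> < f x - l"
    using assms unfolding continuous_on_iff dist_real_def by (metis diff_gt_0_iff_gt)
  have "l < f y" if "y \<in> S" "\<bar>y - x\<bar> < r" for y using r(2)[OF that] by linarith
  with r(1) show thesis by (rule that)
qed

locale nonneg_supersolution =
  fixes mu sig q clo chi :: real and W :: "real \<times> real \<Rightarrow> real"
  assumes visc_super: "visc_super mu sig q clo chi W"
    and nonneg: "0 \<le> x \<Longrightarrow> clo \<le> c \<Longrightarrow> c < chi \<Longrightarrow> 0 \<le> W (x, c)"
begin

abbreviation states :: "(real \<times> real) set" where
  "states \<equiv> {0..} \<times> {clo..<chi}"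

lemma continuous_on_states: "continuous_on states W"
  using visc_super by (simp add: visc_super_def loc_lipschitz_on_imp_continuous_on)

lemma separable_test:
  assumes x: "0 < x" and c: "clo \<le> c" "c < chi"
    and f: "\<And>y. (f has_real_derivative f' y) (at y)" "\<And>y. (f' has_real_derivative f'' y) (at y)"
      "continuous_on UNIV f''"
    and g: "\<And>d. (g has_real_derivative g' d) (at d)" "continuous_on UNIV g'"
    and touch: "f x + g c = W (x, c)"
    and below: "\<And>y d. 0 \<le> y \<Longrightarrow> clo \<le> d \<Longrightarrow> d < chi \<Longrightarrow> f y + g d \<le> W (y, d)"
  shows "gen_op mu sig q c (W (x, c)) (f' x) (f'' x) \<le> 0" "g' c \<le> 0"
proof -
  have "max (gen_op mu sig q c (W (x, c)) (f' x) (f'' x)) (g' c) \<le> 0"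
    using visc_super[unfolded visc_super_def, THEN conjunct2, rule_format, of x c
        "\<lambda>(y, d). f y + g d" "\<lambda>(y, d). f' y" "\<lambda>(y, d). g' d" "\<lambda>(y, d). f'' y"]
      diff21_separable[OF f g] x c touch below by simp
  then show "gen_op mu sig q c (W (x, c)) (f' x) (f'' x) \<le> 0" "g' c \<le> 0" by auto
qed

lemma local_minorant_test:
  assumes x: "0 < x" and c: "clo \<le> c" "c < chi" and d: "0 < d"
    and g: "\<And>r. (g has_real_derivative g' r) (at r)" "continuous_on UNIV g'"
    and below: "\<And>y r. 0 \<le> y \<Longrightarrow> clo \<le> r \<Longrightarrow> r < chi \<Longrightarrow> \<bar>y - x\<bar> < d \<Longrightarrow> \<bar>r - c\<bar> < d \<Longrightarrow>
      W (x, c) + a * (y - x) + b / 2 * (y - x)\<^sup>2 + (g r - g c) \<le> W (y, r)"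
  shows "gen_op mu sig q c (W (x, c)) a b \<le> 0" "g' c \<le> 0"
proof -
  have "continuous_on {clo..chi} g"
    using g(1) by (meson DERIV_continuous_on has_field_derivative_at_within)
  then have "compact (g ` {clo..chi})" by (intro compact_continuous_image) auto
  then obtain G where G: "\<And>r. clo \<le> r \<Longrightarrow> r < chi \<Longrightarrow> \<bar>g r\<bar> \<le> G"
    by (force dest!: compact_imp_bounded simp: bounded_iff)
  obtain N where N: "0 \<le> N"
    and penalty: "\<And>u v. d \<le> \<bar>u\<bar> \<or> d \<le> \<bar>v\<bar> \<Longrightarrow>
      W (x, c) + (G - g c) + a * u + b / 2 * u\<^sup>2 \<le> N * u^4 + N * v\<^sup>2"
    using quartic_penalty_dominates_outside_box[OF d] by blast
  define \<phi> where "\<phi> = (\<lambda>y. W (x, c) + a * (y - x) + b / 2 * (y - x)\<^sup>2 - N * (y - x)^4)"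
  define \<psi> where "\<psi> = (\<lambda>r. g r - g c - N * (r - c)\<^sup>2)"
  have "\<phi> y + \<psi> r \<le> W (y, r)" if "0 \<le> y" "clo \<le> r" "r < chi" for y r
  proof (cases "\<bar>y - x\<bar> < d \<and> \<bar>r - c\<bar> < d")
    case True
    have "0 \<le> N * (y - x)^4" "0 \<le> N * (r - c)\<^sup>2" using N by simp_all
    then show ?thesis using below[OF that] True unfolding \<phi>_def \<psi>_def by linarith
  next
    case False
    then have "d \<le> \<bar>y - x\<bar> \<or> d \<le> \<bar>r - c\<bar>" by auto
    then have "\<phi> y + \<psi> r \<le> 0"
      using penalty[of "y - x" "r - c"] G[OF that(2,3)] unfolding \<phi>_def \<psi>_def by linarith
    then show ?thesis using nonneg[OF that] by simp
  qed
  moreover have "(\<phi> has_real_derivative a + b * (y - x) - 4 * N * (y - x)^3) (at y)" for y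
    unfolding \<phi>_def by (auto intro!: derivative_eq_intros)
  moreover have "((\<lambda>y. a + b * (y - x) - 4 * N * (y - x)^3) has_real_derivative
      b - 12 * N * (y - x)\<^sup>2) (at y)" for y
    by (auto intro!: derivative_eq_intros)
  moreover have "(\<psi> has_real_derivative g' r - 2 * N * (r - c)) (at r)" for r
    unfolding \<psi>_def using g(1) by (auto intro!: derivative_eq_intros)
  moreover have "continuous_on UNIV (\<lambda>y. b - 12 * N * (y - x)\<^sup>2)"
    "continuous_on UNIV (\<lambda>r. g' r - 2 * N * (r - c))"
    using g(2) by (auto intro!: continuous_intros)
  moreover have "\<phi> x + \<psi> c = W (x, c)" by (simp add: \<phi>_def \<psi>_def)
  ultimately show "gen_op mu sig q c (W (x, c)) a b \<le> 0" "g' c \<le> 0"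
    using separable_test[OF x c, of \<phi> "\<lambda>y. a + b * (y - x) - 4 * N * (y - x)^3"
        "\<lambda>y. b - 12 * N * (y - x)\<^sup>2" \<psi> "\<lambda>r. g' r - 2 * N * (r - c)"] by auto
qed

lemma local_min_test:
  assumes x: "0 < x" and c: "clo \<le> c" "c < chi"
    and f: "\<And>y. (f has_real_derivative f' y) (at y)" "\<And>y. (f' has_real_derivative f'' y) (at y)"
      "isCont f'' x"
    and g: "\<And>r. (g has_real_derivative g' r) (at r)" "continuous_on UNIV g'"
    and local_min: "\<forall>\<^sub>F p in nhds (x, c). p \<in> states \<longrightarrow>
      W (x, c) - (f x + g c) \<le> W p - (f (fst p) + g (snd p))"
  shows "gen_op mu sig q c (W (x, c)) (f' x) (f'' x) \<le> 0" "g' c \<le> 0"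
proof -
  have perturbed: "gen_op mu sig q c (W (x, c)) (f' x) (f'' x - e) \<le> 0 \<and> g' c \<le> 0" if e: "0 < e" for e
  proof -
    have "\<forall>\<^sub>F p in nhds x \<times>\<^sub>F nhds c.
        f x + f' x * (fst p - x) + (f'' x - e) / 2 * (fst p - x)\<^sup>2 \<le> f (fst p)"
      using second_order_Taylor_lower_bound[OF f e]
      by (rule eventually_compose_filterlim[OF _ filterlim_fst])
    with local_min have "\<forall>\<^sub>F p in nhds (x, c). p \<in> states \<longrightarrow> W (x, c) + f' x * (fst p - x) +
        (f'' x - e) / 2 * (fst p - x)\<^sup>2 + (g (snd p) - g c) \<le> W p"
      unfolding nhds_prod by eventually_elim auto
    then obtain P Q where "eventually P (nhds x)" "eventually Q (nhds c)"
      and PQ: "\<And>y r. P y \<Longrightarrow> Q r \<Longrightarrow> (y, r) \<in> states \<Longrightarrow>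
        W (x, c) + f' x * (y - x) + (f'' x - e) / 2 * (y - x)\<^sup>2 + (g r - g c) \<le> W (y, r)"
      unfolding nhds_prod eventually_prod_filter by auto
    then obtain d1 d2 where "0 < d1" "0 < d2"
      "\<And>y. \<bar>y - x\<bar> < d1 \<Longrightarrow> P y" "\<And>r. \<bar>r - c\<bar> < d2 \<Longrightarrow> Q r"
      unfolding eventually_nhds_metric dist_real_def by blast
    then show ?thesis
      using PQ
      by (intro conjI local_minorant_test[OF x c, of "min d1 d2" g g' "f' x" "f'' x - e"] g) auto
  qed
  show "g' c \<le> 0" using perturbed[of 1] by simp
  have "((\<lambda>e. gen_op mu sig q c (W (x, c)) (f' x) (f'' x - e)) \<longlongrightarrow>
      gen_op mu sig q c (W (x, c)) (f' x) (f'' x - 0)) (at_right 0)"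
    unfolding gen_op_def by (intro tendsto_intros)
  then show "gen_op mu sig q c (W (x, c)) (f' x) (f'' x) \<le> 0"
    using perturbed by (intro tendsto_upperbound[of _ _ "at_right 0"])
      (auto intro!: eventually_at_rightI[of 0 1])
qed

text \<open>Only the part of the frontier of the box in the interior of the state space has to be excluded:
  the edge \<open>c = clo\<close> belongs to the region where the supersolution property holds.\<close>

lemma box_min_test:
  assumes box: "0 < a" "clo \<le> lo" "hi < chi"
    and f: "\<And>y. (f has_real_derivative f' y) (at y)" "\<And>y. (f' has_real_derivative f'' y) (at y)"
      "continuous_on UNIV f''"
    and g: "\<And>r. (g has_real_derivative g' r) (at r)" "continuous_on UNIV g'"
    and start: "x0 \<in> {a..b}" "c0 \<in> {lo..hi}"
    and sides: "\<And>r. r \<in> {lo..hi} \<Longrightarrow> W (x0, c0) - (f x0 + g c0) < W (a, r) - (f a + g r)"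
      "\<And>r. r \<in> {lo..hi} \<Longrightarrow> W (x0, c0) - (f x0 + g c0) < W (b, r) - (f b + g r)"
    and top: "\<And>y. y \<in> {a..b} \<Longrightarrow> W (x0, c0) - (f x0 + g c0) < W (y, hi) - (f y + g hi)"
    and bottom: "\<And>y. clo < lo \<Longrightarrow> y \<in> {a..b} \<Longrightarrow> W (x0, c0) - (f x0 + g c0) < W (y, lo) - (f y + g lo)"
  obtains x c where "x \<in> {a..b}" "c \<in> {lo..hi}"
    "W (x, c) - (f x + g c) \<le> W (x0, c0) - (f x0 + g c0)"
    "gen_op mu sig q c (W (x, c)) (f' x) (f'' x) \<le> 0" "g' c \<le> 0"
proof -
  define \<Phi> where "\<Phi> = (\<lambda>p. W p - (f (fst p) + g (snd p)))"
  have "continuous_on UNIV f" "continuous_on UNIV g"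
    using f g by (meson DERIV_continuous_on has_field_derivative_at_within)+
  moreover have "continuous_on ({a..b} \<times> {lo..hi}) W"
    using box by (intro continuous_on_subset[OF continuous_on_states]) auto
  ultimately have "continuous_on ({a..b} \<times> {lo..hi}) \<Phi>"
    unfolding \<Phi>_def
    by (auto intro!: continuous_intros continuous_on_compose2[of UNIV f]
      continuous_on_compose2[of UNIV g])
  moreover have "compact ({a..b} \<times> {lo..hi})" by (intro compact_Times compact_Icc)
  ultimately obtain p where p: "p \<in> {a..b} \<times> {lo..hi}" "\<And>p'. p' \<in> {a..b} \<times> {lo..hi} \<Longrightarrow> \<Phi> p \<le> \<Phi> p'"
    using start continuous_attains_inf[of "{a..b} \<times> {lo..hi}" \<Phi>] by blast
  obtain x c where xc: "p = (x, c)" by (cases p)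
  have min_le: "\<Phi> (x, c) \<le> \<Phi> (x0, c0)" using p(2)[of "(x0, c0)"] start by (simp add: xc)
  have interior: "a < x" "x < b" "c < hi" "clo < lo \<Longrightarrow> lo < c"
  proof -
    have "x \<noteq> a" using sides(1)[of c] min_le p(1) by (auto simp: \<Phi>_def xc)
    moreover have "x \<noteq> b" using sides(2)[of c] min_le p(1) by (auto simp: \<Phi>_def xc)
    moreover have "c \<noteq> hi" using top[of x] min_le p(1) by (auto simp: \<Phi>_def xc)
    moreover have "c \<noteq> lo" if "clo < lo"
      using bottom[OF that, of x] min_le p(1) by (auto simp: \<Phi>_def xc)
    ultimately show "a < x" "x < b" "c < hi" "clo < lo \<Longrightarrow> lo < c" using p(1) by (auto simp: xc)
  qed
  have "\<forall>\<^sub>F p' in nhds (x, c). p' \<in> {a<..<b} \<times> {if clo < lo then lo else c - 1<..<hi}"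
    using interior by (intro eventually_nhds_in_open open_Times) auto
  then have "\<forall>\<^sub>F p' in nhds (x, c). p' \<in> states \<longrightarrow> \<Phi> (x, c) \<le> \<Phi> p'"
    by eventually_elim (use box p(2) in \<open>auto simp: xc split: if_splits\<close>)
  then have "gen_op mu sig q c (W (x, c)) (f' x) (f'' x) \<le> 0" "g' c \<le> 0"
    using local_min_test[OF _ _ _ f(1,2) _ g, of x c] f(3) p(1) interior box
    by (auto simp: \<Phi>_def xc continuous_on_eq_continuous_at)
  then show thesis using that[of x c] p(1) min_le by (simp add: \<Phi>_def xc)
qed

lemma continuous_on_section:
  shows "clo \<le> c \<Longrightarrow> c < chi \<Longrightarrow> continuous_on {0..} (\<lambda>x. W (x, c))"
    and "0 \<le> x \<Longrightarrow> continuous_on {clo..<chi} (\<lambda>c. W (x, c))"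
  by (intro continuous_on_compose2[OF continuous_on_states] continuous_intros; auto)+

lemma antimono_rate:
  assumes x: "0 < x" and c: "clo \<le> c1" "c1 \<le> c2" "c2 < chi"
  shows "W (x, c2) \<le> W (x, c1)"
proof (rule ccontr)
  assume "\<not> ?thesis"
  then have increase: "W (x, c1) < W (x, c2)" by simp
  then have "c1 < c2" using c by (cases "c1 = c2") auto
  define mid where "mid = (W (x, c1) + W (x, c2)) / 2"
  define s where "s = (mid - W (x, c1)) / (c2 - c1)"
  have mid: "W (x, c1) < mid" "mid < W (x, c2)" using increase by (simp_all add: mid_def)
  have s: "0 < s" "s * (c2 - c1) = mid - W (x, c1)"
    using \<open>c1 < c2\<close> mid by (simp_all add: s_def)
  obtain r where "0 < r" and near: "\<And>y. y \<in> {0..} \<Longrightarrow> \<bar>y - x\<bar> < r \<Longrightarrow> mid < W (y, c2)"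
    by (rule continuous_on_gt_near[OF continuous_on_section(1)[of c2] _ mid(2)]) (use c x in auto)
  define d where "d = min (x / 2) (r / 2)"
  have d: "0 < d" "d < x" "d < r" using x \<open>0 < r\<close> by (auto simp: d_def)
  define N where "N = (mid + 1) / d\<^sup>2"
  have "0 \<le> W (x, c1)" using nonneg x c by simp
  then have N: "0 \<le> N" "N * d\<^sup>2 = mid + 1" using mid d by (simp_all add: N_def)
  define f where "f = (\<lambda>y. - N * (y - x)\<^sup>2)"
  define g where "g = (\<lambda>r. s * (r - c1))"
  have start: "W (x, c1) - (f x + g c1) = W (x, c1)" by (simp add: f_def g_def)
  have "s \<le> 0"
  proof (rule box_min_test[of "x - d" clo c2 f "\<lambda>y. - 2 * N * (y - x)" "\<lambda>_. - 2 * N" g "\<lambda>_. s"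
        x "x + d" c1])
    fix r assume r: "r \<in> {clo..c2}"
    have "g r \<le> mid - W (x, c1)"
      unfolding g_def s(2)[symmetric] using s r by (intro mult_left_mono) auto
    moreover have "0 \<le> W (x - d, r)" "0 \<le> W (x + d, r)" using nonneg d c r by auto
    ultimately show "W (x, c1) - (f x + g c1) < W (x - d, r) - (f (x - d) + g r)"
      "W (x, c1) - (f x + g c1) < W (x + d, r) - (f (x + d) + g r)"
      using N unfolding start by (simp_all add: f_def)
  next
    fix y assume "y \<in> {x - d..x + d}"
    then have "mid < W (y, c2)" using d by (intro near) auto
    moreover have "f y \<le> 0" using N by (simp add: f_def)
    ultimately show "W (x, c1) - (f x + g c1) < W (y, c2) - (f y + g c2)"
      using s(2) unfolding start by (simp add: g_def)
  qed (use c d in \<open>auto simp: f_def g_def intro!: derivative_eq_intros continuous_intros\<close>)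
  then show False using s by simp
qed

lemma lower_bounds_near_rate:
  assumes c0: "clo \<le> c0" "c0 < chi" and ab: "0 \<le> a" "0 \<le> b" and e: "0 < e"
    and lower: "l < W (a, c0)" "l' < W (b, c0)"
  obtains d where "0 < d" "d \<le> e" "c0 + d < chi"
    "\<And>c. clo \<le> c \<Longrightarrow> \<bar>c - c0\<bar> \<le> d \<Longrightarrow> l < W (a, c) \<and> l' < W (b, c)"
proof -
  obtain ra where ra: "0 < ra" "\<And>c. c \<in> {clo..<chi} \<Longrightarrow> \<bar>c - c0\<bar> < ra \<Longrightarrow> l < W (a, c)"
    by (rule continuous_on_gt_near[OF continuous_on_section(2)[OF ab(1)] _ lower(1)]) (use c0 in auto)
  obtain rb where rb: "0 < rb" "\<And>c. c \<in> {clo..<chi} \<Longrightarrow> \<bar>c - c0\<bar> < rb \<Longrightarrow> l' < W (b, c)"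
    by (rule continuous_on_gt_near[OF continuous_on_section(2)[OF ab(2)] _ lower(2)]) (use c0 in auto)
  define d where "d = Min {ra / 2, rb / 2, (chi - c0) / 2, e}"
  have small: "d \<le> ra / 2" "d \<le> rb / 2" "d \<le> (chi - c0) / 2" "d \<le> e"
    unfolding d_def by (intro Min_le; simp)+
  have d: "0 < d" "d < ra" "d < rb" "c0 + d < chi"
    using small(1-3) ra(1) rb(1) c0 e by (auto simp: d_def field_simps)
  show thesis
    using ra(2) rb(2) d small(4) by (intro that[of d]) (auto simp: abs_le_iff abs_less_iff)
qed

lemma violated_comparison_test:
  assumes c0: "clo \<le> c0" "c0 < chi" and ab: "0 < a" "y \<in> {a..b}"
    and h: "\<And>x. (h has_real_derivative h' x) (at x)" "\<And>x. (h' has_real_derivative h'' x) (at x)"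
      "continuous_on UNIV h''"
    and ends: "h a \<le> W (a, c0)" "h b \<le> W (b, c0)"
    and violated: "W (y, c0) < h y" and e: "0 < e"
  obtains x c where "x \<in> {a..b}" "\<bar>c - c0\<bar> \<le> e" "W (x, c) + (h y - W (y, c0)) \<le> h x"
    "gen_op mu sig q c (W (x, c)) (h' x) (h'' x) \<le> 0"
proof -
  define m where "m = h y - W (y, c0)"
  have m: "0 < m" using violated by (simp add: m_def)
  have "continuous_on {a..b} h"
    using h by (meson DERIV_continuous_on has_field_derivative_at_within)
  then have "bounded (h ` {a..b})"
    by (auto intro!: compact_imp_bounded compact_continuous_image)
  then obtain H where H: "\<And>x. x \<in> {a..b} \<Longrightarrow> \<bar>h x\<bar> \<le> H"
    unfolding bounded_iff real_norm_def by blast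
  have "h a - m < W (a, c0)" "h b - m < W (b, c0)" using ends m by linarith+
  then obtain d where d: "0 < d" "d \<le> e" "c0 + d < chi"
    and near: "\<And>c. clo \<le> c \<Longrightarrow> \<bar>c - c0\<bar> \<le> d \<Longrightarrow> h a - m < W (a, c) \<and> h b - m < W (b, c)"
    using lower_bounds_near_rate[OF c0 _ _ e, of a b] ab by auto
  define N where "N = H / d\<^sup>2"
  have N: "0 \<le> N" "N * d\<^sup>2 = H" using H[OF ab(2)] d by (simp_all add: N_def)
  define g where "g = (\<lambda>c. - N * (c - c0)\<^sup>2)"
  have g_nonpos: "g c \<le> 0" for c using N(1) by (simp add: g_def)
  have start: "W (y, c0) - (h y + g c0) = - m" by (simp add: g_def m_def)
  have far: "- m < W (x, r) - (h x + g r)"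
    if "x \<in> {a..b}" "clo \<le> r" "r < chi" "\<bar>r - c0\<bar> = d" for x r
  proof -
    have "(r - c0)\<^sup>2 = d\<^sup>2" unfolding that(4)[symmetric] by simp
    then show ?thesis
      using nonneg[of x r] that H[OF that(1)] ab N m by (simp add: abs_le_iff g_def)
  qed
  obtain x c where "x \<in> {a..b}" "c \<in> {max clo (c0 - d)..c0 + d}"
    "W (x, c) - (h x + g c) \<le> W (y, c0) - (h y + g c0)"
    "gen_op mu sig q c (W (x, c)) (h' x) (h'' x) \<le> 0"
  proof (rule box_min_test[OF ab(1) _ _ h, where lo = "max clo (c0 - d)" and hi = "c0 + d" and g = g
        and g' = "\<lambda>c. - 2 * N * (c - c0)" and ?x0.0 = y and b = b and ?c0.0 = c0])
    show "W (y, c0) - (h y + g c0) < W (a, r) - (h a + g r)"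
      "W (y, c0) - (h y + g c0) < W (b, r) - (h b + g r)"
      if "r \<in> {max clo (c0 - d)..c0 + d}" for r
      using near[of r] that g_nonpos[of r] unfolding start by (auto simp: abs_le_iff)
    show "W (y, c0) - (h y + g c0) < W (x, c0 + d) - (h x + g (c0 + d))" if "x \<in> {a..b}" for x
      using far[of x "c0 + d"] that d c0 unfolding start by simp
    show "W (y, c0) - (h y + g c0) < W (x, max clo (c0 - d)) - (h x + g (max clo (c0 - d)))"
      if "clo < max clo (c0 - d)" "x \<in> {a..b}" for x
      using far[of x "c0 - d"] that d c0 unfolding start by (simp add: max_def split: if_splits)
  qed (use ab c0 d in \<open>auto simp: g_def intro!: derivative_eq_intros continuous_intros\<close>)
  then show thesis
    using that[of x c] d(2) g_nonpos[of c] unfolding start by (auto simp: m_def abs_le_iff)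
qed

lemma ge_classical_subsolution:
  assumes q: "0 < q" and c0: "clo \<le> c0" "c0 < chi" and ab: "0 < a" "y \<in> {a..b}"
    and h: "\<And>x. (h has_real_derivative h' x) (at x)" "\<And>x. (h' has_real_derivative h'' x) (at x)"
      "continuous_on UNIV h''"
    and sub: "\<And>x. x \<in> {a..b} \<Longrightarrow> 0 \<le> gen_op mu sig q c0 (h x) (h' x) (h'' x)"
    and ends: "h a \<le> W (a, c0)" "h b \<le> W (b, c0)"
  shows "h y \<le> W (y, c0)"
proof (rule ccontr)
  define m where "m = h y - W (y, c0)"
  assume "\<not> ?thesis"
  then have violated: "W (y, c0) < h y" and m: "0 < m" by (simp_all add: m_def)
  have "continuous_on {a..b} h'"
    using h by (meson DERIV_continuous_on has_field_derivative_at_within)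
  then have "bounded (h' ` {a..b})"
    by (auto intro!: compact_imp_bounded compact_continuous_image)
  then obtain H where H: "\<And>x. x \<in> {a..b} \<Longrightarrow> \<bar>h' x\<bar> \<le> H"
    unfolding bounded_iff real_norm_def by blast
  have "0 \<le> H" using H[OF ab(2)] by linarith
  define e where "e = q * m / (2 * (1 + H))"
  have "0 < e" using q m \<open>0 \<le> H\<close> by (simp add: e_def)
  then obtain x c where x: "x \<in> {a..b}" and c: "\<bar>c - c0\<bar> \<le> e" and "W (x, c) + m \<le> h x"
    and super: "gen_op mu sig q c (W (x, c)) (h' x) (h'' x) \<le> 0"
    using violated_comparison_test[OF c0 ab h ends violated] unfolding m_def by metis
  then have "q * m \<le> q * (h x - W (x, c))" using q by simp
  also have "\<dots> = gen_op mu sig q c (W (x, c)) (h' x) (h'' x) - gen_op mu sig q c0 (h x) (h' x) (h'' x)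
      + (c - c0) * (h' x - 1)"
    by (simp add: gen_op_def algebra_simps)
  also have "\<dots> \<le> (c - c0) * (h' x - 1)" using super sub[OF x] by simp
  also have "\<dots> \<le> \<bar>c - c0\<bar> * \<bar>h' x - 1\<bar>" unfolding abs_mult[symmetric] by (rule abs_ge_self)
  also have "\<dots> \<le> e * (1 + H)" using c H[OF x] \<open>0 < e\<close> by (intro mult_mono) auto
  also have "\<dots> = q * m / 2" using \<open>0 \<le> H\<close> by (simp add: e_def field_simps)
  finally show False using q m by simp
qed

end

section \<open>Supporting solutions of the linear equation\<close>

definition pos_char_root :: "real \<Rightarrow> real \<Rightarrow> real \<Rightarrow> real" where
  "pos_char_root sig q m = (sqrt (m\<^sup>2 + 2 * sig\<^sup>2 * q) - m) / sig\<^sup>2"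

definition neg_char_root :: "real \<Rightarrow> real \<Rightarrow> real \<Rightarrow> real" where
  "neg_char_root sig q m = (- sqrt (m\<^sup>2 + 2 * sig\<^sup>2 * q) - m) / sig\<^sup>2"

lemma char_roots_sign:
  assumes "0 < sig" "0 < q"
  shows "0 < pos_char_root sig q m" "neg_char_root sig q m < 0"
proof -
  have "\<bar>m\<bar> < sqrt (m\<^sup>2 + 2 * sig\<^sup>2 * q)"
    using assms by (intro real_less_rsqrt) auto
  then show "0 < pos_char_root sig q m" "neg_char_root sig q m < 0"
    using assms by (auto simp: pos_char_root_def neg_char_root_def divide_simps)
qed

lemma char_roots_equation:
  assumes "0 < sig" "0 \<le> q"
  shows "sig\<^sup>2 / 2 * (pos_char_root sig q m)\<^sup>2 + m * pos_char_root sig q m = q"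
    and "sig\<^sup>2 / 2 * (neg_char_root sig q m)\<^sup>2 + m * neg_char_root sig q m = q"
proof -
  define R where "R = sqrt (m\<^sup>2 + 2 * sig\<^sup>2 * q)"
  have R: "R\<^sup>2 = m\<^sup>2 + 2 * sig\<^sup>2 * q" using assms by (simp add: R_def)
  have "sig\<^sup>2 / 2 * (e / sig\<^sup>2)\<^sup>2 + m * (e / sig\<^sup>2) = ((e + m)\<^sup>2 - m\<^sup>2) / (2 * sig\<^sup>2)" for e
    using assms by (simp add: field_simps power2_eq_square)
  from this[of "R - m"] this[of "- R - m"]
  show "sig\<^sup>2 / 2 * (pos_char_root sig q m)\<^sup>2 + m * pos_char_root sig q m = q"
    "sig\<^sup>2 / 2 * (neg_char_root sig q m)\<^sup>2 + m * neg_char_root sig q m = q"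
    using assms R by (simp_all add: pos_char_root_def neg_char_root_def R_def[symmetric])
qed

lemma gen_op_exp_solution:
  assumes "q \<noteq> 0" "sig\<^sup>2 / 2 * th1\<^sup>2 + (mu - c) * th1 = q" "sig\<^sup>2 / 2 * th2\<^sup>2 + (mu - c) * th2 = q"
  shows "gen_op mu sig q c (c / q + A * exp (th1 * x) + B * exp (th2 * x))
    (A * th1 * exp (th1 * x) + B * th2 * exp (th2 * x))
    (A * th1\<^sup>2 * exp (th1 * x) + B * th2\<^sup>2 * exp (th2 * x)) = 0"
proof -
  have "gen_op mu sig q c (c / q + A * exp (th1 * x) + B * exp (th2 * x))
      (A * th1 * exp (th1 * x) + B * th2 * exp (th2 * x))
      (A * th1\<^sup>2 * exp (th1 * x) + B * th2\<^sup>2 * exp (th2 * x)) =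
    (sig\<^sup>2 / 2 * th1\<^sup>2 + (mu - c) * th1 - q) * (A * exp (th1 * x)) +
    (sig\<^sup>2 / 2 * th2\<^sup>2 + (mu - c) * th2 - q) * (B * exp (th2 * x))"
    using assms(1) by (simp add: gen_op_def algebra_simps)
  then show ?thesis using assms(2,3) by simp
qed

lemma concave_on_if_above_chords:
  fixes f :: "real \<Rightarrow> real"
  assumes "convex S"
    and chord: "\<And>x y z A B. x \<in> S \<Longrightarrow> z \<in> S \<Longrightarrow> x \<le> y \<Longrightarrow> y \<le> z \<Longrightarrow>
      A * x + B \<le> f x \<Longrightarrow> A * z + B \<le> f z \<Longrightarrow> A * y + B \<le> f y"
  shows "concave_on S f"
proof (rule concave_on_linorderI)
  fix t x z :: real
  assume t: "0 < t" "t < 1" and xz: "x \<in> S" "z \<in> S" "x < z"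
  define y where "y = (1 - t) * x + t * z"
  define A where "A = (f z - f x) / (z - x)"
  define B where "B = f x - A * x"
  have x_eq: "A * x + B = f x" by (simp add: B_def)
  have "A * (z - x) = f z - f x" using xz by (simp add: A_def)
  then have z_eq: "A * z + B = f z" by (simp add: B_def algebra_simps)
  have "x \<le> y" "y \<le> z"
    using t xz convex_bound_le[of x z z "1 - t" t] mult_left_mono[of x z t]
    by (auto simp: y_def algebra_simps)
  then have "A * y + B \<le> f y"
    using chord[OF xz(1,2), of y A B] x_eq z_eq by simp
  moreover have "A * y + B = (1 - t) * f x + t * f z"
    unfolding x_eq[symmetric] z_eq[symmetric] by (simp add: y_def algebra_simps)
  ultimately show "(1 - t) * f x + t * f z \<le> f ((1 - t) *\<^sub>R x + t *\<^sub>R z)"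
    by (simp add: y_def)
qed fact

lemma concave_on_supporting_line:
  fixes f :: "real \<Rightarrow> real"
  assumes f: "concave_on S f" and x: "x \<in> interior S"
  obtains s where "\<And>y. y \<in> S \<Longrightarrow> f y \<le> f x + s * (y - x)"
proof -
  define s where "s = Inf ((\<lambda>t. (- f x - - f t) / (x - t)) ` ({x<..} \<inter> S))"
  have "f y \<le> f x + - s * (y - x)" if "y \<in> S" for y
    using convex_le_Inf_differential[OF f[unfolded concave_on_def] x that] by (simp add: s_def)
  then show thesis by (rule that)
qed

text \<open>In the variable \<open>exp ((th1 - th2) * x)\<close> the combinations of the two exponentials are affine
  functions up to the factor \<open>exp (th2 * x)\<close>.\<close>

lemma exp_combination_support:
  fixes w :: "real \<Rightarrow> real"
  assumes th: "th2 < th1" and x0: "0 < x0"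
    and chord: "\<And>x y z A B. 0 < x \<Longrightarrow> x \<le> y \<Longrightarrow> y \<le> z \<Longrightarrow>
      A * exp (th1 * x) + B * exp (th2 * x) \<le> w x \<Longrightarrow> A * exp (th1 * z) + B * exp (th2 * z) \<le> w z \<Longrightarrow>
      A * exp (th1 * y) + B * exp (th2 * y) \<le> w y"
  obtains A B where "w x0 = A * exp (th1 * x0) + B * exp (th2 * x0)"
    "\<And>x. 0 < x \<Longrightarrow> w x \<le> A * exp (th1 * x) + B * exp (th2 * x)"
proof -
  define k where "k = th1 - th2"
  define X where "X = (\<lambda>z. ln z / k)"
  define G where "G = (\<lambda>z. exp (- th2 * X z) * w (X z))"
  have k: "0 < k" using th by (simp add: k_def)
  have X_exp: "X (exp (k * x)) = x" for x using k by (simp add: X_def)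
  have exp_X: "exp (th1 * X z) = z * exp (th2 * X z)" if "1 < z" for z
  proof -
    have "th1 * X z = k * X z + th2 * X z" by (simp add: k_def algebra_simps)
    moreover have "exp (k * X z) = z" using that k by (simp add: X_def)
    ultimately show ?thesis by (simp add: exp_add)
  qed
  have pull_back: "A * exp (th1 * X z) + B * exp (th2 * X z) = (A * z + B) * exp (th2 * X z)"
    "w (X z) = G z * exp (th2 * X z)" if "1 < z" for A B z
    using exp_X[OF that] by (simp_all add: G_def mult_exp_exp algebra_simps)
  have "concave_on {1<..} G"
  proof (rule concave_on_if_above_chords)
    fix x y z A B assume xyz: "x \<in> {1<..}" "z \<in> {1<..}" "x \<le> y" "y \<le> z"
      and "A * x + B \<le> G x" "A * z + B \<le> G z"
    moreover have "0 < X x" "X x \<le> X y" "X y \<le> X z"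
      using xyz k by (auto simp: X_def intro!: divide_right_mono)
    ultimately show "A * y + B \<le> G y"
      using chord[of "X x" "X y" "X z" A B] by (simp add: pull_back)
  qed simp
  moreover define z0 where "z0 = exp (k * x0)"
  moreover have z0: "1 < z0" using k x0 by (simp add: z0_def)
  ultimately obtain s where s: "\<And>z. z \<in> {1<..} \<Longrightarrow> G z \<le> G z0 + s * (z - z0)"
    using concave_on_supporting_line[of "{1<..}" G z0] by (auto simp: interior_open)
  show thesis
  proof (rule that[of s "G z0 - s * z0"])
    show "w x0 = s * exp (th1 * x0) + (G z0 - s * z0) * exp (th2 * x0)"
      using pull_back(1)[OF z0, of s "G z0 - s * z0"] pull_back(2)[OF z0]
      by (simp add: z0_def X_exp)
    fix x :: real assume "0 < x"
    then have z: "1 < exp (k * x)" using k by simp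
    have "G (exp (k * x)) \<le> s * exp (k * x) + (G z0 - s * z0)"
      using s[of "exp (k * x)"] z by (simp add: algebra_simps)
    then show "w x \<le> s * exp (th1 * x) + (G z0 - s * z0) * exp (th2 * x)"
      using pull_back(1)[OF z, of s "G z0 - s * z0"] pull_back(2)[OF z] by (simp add: X_exp)
  qed
qed

lemma exp_combination_nonneg_imp_coeff_nonneg:
  fixes A B c e th1 th2 :: real
  assumes th: "0 < th1" "th2 < 0"
    and nonneg: "\<And>z. e \<le> z \<Longrightarrow> 0 \<le> c + A * exp (th1 * z) + B * exp (th2 * z)"
  shows "0 \<le> A"
proof (rule tendsto_lowerbound)
  have "((\<lambda>z. c * exp (- th1 * z) + A + B * exp ((th2 - th1) * z)) \<longlongrightarrow> c * 0 + A + B * 0) at_top"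
    using th by (intro tendsto_intros filterlim_compose[OF exp_at_bot]
      filterlim_tendsto_neg_mult_at_bot[OF tendsto_const _ filterlim_ident]) auto
  then show "((\<lambda>z. c * exp (- th1 * z) + A + B * exp ((th2 - th1) * z)) \<longlongrightarrow> A) at_top" by simp
  show "\<forall>\<^sub>F z in at_top. 0 \<le> c * exp (- th1 * z) + A + B * exp ((th2 - th1) * z)"
    using eventually_ge_at_top[of e]
  proof eventually_elim
    case (elim z)
    have "c * exp (- th1 * z) + A + B * exp ((th2 - th1) * z) =
        exp (- th1 * z) * (c + A * exp (th1 * z) + B * exp (th2 * z))"
      by (simp add: algebra_simps mult_exp_exp)
    then show ?case using nonneg[OF elim] by simp
  qed
qed simp

lemma exp_combination_decaying_coeff_ge:
  fixes A B c e M th1 th2 :: real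
  assumes th: "0 < th1" "th2 < 0" and c: "0 \<le> c" and e: "0 < e"
    and nonneg: "\<And>z. - e \<le> z \<Longrightarrow> 0 \<le> c + A * exp (th1 * z) + B * exp (th2 * z)"
    and le: "c + A + B \<le> M"
  shows "- ((c + M) / (exp (- th2 * e) - exp (- th1 * e))) \<le> B"
proof -
  define D where "D = exp (- th2 * e) - exp (- th1 * e)"
  have D: "0 < D" using th e by (simp add: D_def mult_neg_pos)
  have "0 \<le> c + A + B" using nonneg[of 0] e by simp
  have "0 \<le> c + (A + B) * exp (- th1 * e) + B * D"
    using nonneg[of "- e"] by (simp add: D_def algebra_simps)
  also have "(A + B) * exp (- th1 * e) \<le> (c + A + B) * exp (- th1 * e)"
    using c by (intro mult_right_mono) auto
  also have "\<dots> \<le> (c + A + B) * 1"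
    using th e \<open>0 \<le> c + A + B\<close> by (intro mult_left_mono) auto
  finally have "- (c + M) \<le> B * D" using le by simp
  then have "- (c + M) / D \<le> B" using D pos_divide_le_eq by blast
  then show ?thesis unfolding D_def minus_divide_left .
qed

locale bounded_supersolution = nonneg_supersolution +
  assumes sig_pos: "0 < sig" and q_pos: "0 < q" and clo_nonneg: "0 \<le> clo"
    and le_max: "0 \<le> x \<Longrightarrow> clo \<le> c \<Longrightarrow> c < chi \<Longrightarrow> W (x, c) \<le> chi / q"
begin

abbreviation \<theta>\<^sub>1 :: "real \<Rightarrow> real" where
  "\<theta>\<^sub>1 d \<equiv> pos_char_root sig q (mu - d)"

abbreviation \<theta>\<^sub>2 :: "real \<Rightarrow> real" where
  "\<theta>\<^sub>2 d \<equiv> neg_char_root sig q (mu - d)"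

lemmas roots_sign = char_roots_sign[OF sig_pos q_pos]

lemma ge_exp_solution:
  assumes d: "clo \<le> d" "d < chi" and ab: "0 < a" "a \<le> y" "y \<le> b"
    and ends: "d / q + A * exp (\<theta>\<^sub>1 d * a) + B * exp (\<theta>\<^sub>2 d * a) \<le> W (a, d)"
      "d / q + A * exp (\<theta>\<^sub>1 d * b) + B * exp (\<theta>\<^sub>2 d * b) \<le> W (b, d)"
  shows "d / q + A * exp (\<theta>\<^sub>1 d * y) + B * exp (\<theta>\<^sub>2 d * y) \<le> W (y, d)"
proof -
  define h where "h = (\<lambda>x. d / q + A * exp (\<theta>\<^sub>1 d * x) + B * exp (\<theta>\<^sub>2 d * x))"
  define h' where "h' = (\<lambda>x. A * \<theta>\<^sub>1 d * exp (\<theta>\<^sub>1 d * x) + B * \<theta>\<^sub>2 d * exp (\<theta>\<^sub>2 d * x))"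
  define h'' where "h'' = (\<lambda>x. A * (\<theta>\<^sub>1 d)\<^sup>2 * exp (\<theta>\<^sub>1 d * x) + B * (\<theta>\<^sub>2 d)\<^sup>2 * exp (\<theta>\<^sub>2 d * x))"
  have "gen_op mu sig q d (h x) (h' x) (h'' x) = 0" for x
    unfolding h_def h'_def h''_def
    using q_pos sig_pos by (intro gen_op_exp_solution char_roots_equation) auto
  moreover have "(h has_real_derivative h' x) (at x)" "(h' has_real_derivative h'' x) (at x)" for x
    unfolding h_def h'_def h''_def
    by (auto intro!: derivative_eq_intros simp: power2_eq_square algebra_simps)
  moreover have "continuous_on UNIV h''" unfolding h''_def by (intro continuous_intros)
  ultimately have "h y \<le> W (y, d)"
    using ab ends
    by (intro ge_classical_subsolution[OF q_pos d, of a y b h h' h'']) (auto simp: h_def)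
  then show ?thesis by (simp add: h_def)
qed

lemma supporting_solution:
  assumes x: "0 < x" and d: "clo \<le> d" "d < chi"
  obtains A B where "W (x, d) = d / q + A + B"
    "\<And>z. - x < z \<Longrightarrow> W (x + z, d) \<le> d / q + A * exp (\<theta>\<^sub>1 d * z) + B * exp (\<theta>\<^sub>2 d * z)"
proof -
  obtain A B where touch: "W (x, d) - d / q = A * exp (\<theta>\<^sub>1 d * x) + B * exp (\<theta>\<^sub>2 d * x)"
    and above: "\<And>y. 0 < y \<Longrightarrow> W (y, d) - d / q \<le> A * exp (\<theta>\<^sub>1 d * y) + B * exp (\<theta>\<^sub>2 d * y)"
  proof (rule exp_combination_support[of "\<theta>\<^sub>2 d" "\<theta>\<^sub>1 d" x "\<lambda>y. W (y, d) - d / q", OF _ x])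
    show "\<theta>\<^sub>2 d < \<theta>\<^sub>1 d" using roots_sign[of "mu - d"] by simp
    show "A * exp (\<theta>\<^sub>1 d * y) + B * exp (\<theta>\<^sub>2 d * y) \<le> W (y, d) - d / q"
      if "0 < a" "a \<le> y" "y \<le> b" "A * exp (\<theta>\<^sub>1 d * a) + B * exp (\<theta>\<^sub>2 d * a) \<le> W (a, d) - d / q"
        "A * exp (\<theta>\<^sub>1 d * b) + B * exp (\<theta>\<^sub>2 d * b) \<le> W (b, d) - d / q" for a y b A B
      using ge_exp_solution[OF d that(1-3), of A B] that(4,5) by simp
  qed (rule that)
  show thesis
  proof (rule that)
    show "W (x, d) = d / q + A * exp (\<theta>\<^sub>1 d * x) + B * exp (\<theta>\<^sub>2 d * x)" using touch by simp
    show "W (x + z, d) \<le> d / q + A * exp (\<theta>\<^sub>1 d * x) * exp (\<theta>\<^sub>1 d * z) +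
        B * exp (\<theta>\<^sub>2 d * x) * exp (\<theta>\<^sub>2 d * z)"
      if "- x < z" for z
      using above[of "x + z"] that by (simp add: distrib_left exp_add)
  qed
qed

text \<open>Thanks to the shift by \<open>eps\<close>, the supporting solution through \<open>W (x + eps, d)\<close> fails to dominate
  the killed value only after a jump of size at least \<open>eps\<close>.\<close>

definition killed_shift :: "real \<Rightarrow> real \<times> real \<Rightarrow> real" where
  "killed_shift eps p = (if p \<in> states then W (fst p + eps, snd p) else 0)"

abbreviation killed_value :: "real \<Rightarrow> real \<times> real \<Rightarrow> ennreal" where
  "killed_value eps \<equiv> (\<lambda>p. ennreal (killed_shift eps p))"

definition overshoot_const :: "real \<Rightarrow> real \<Rightarrow> real" where
  "overshoot_const eps d =
    (d / q + chi / q) / (exp (- \<theta>\<^sub>2 d * (eps / 2)) - exp (- \<theta>\<^sub>1 d * (eps / 2)))"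

lemma killed_shift_nonneg: "0 \<le> eps \<Longrightarrow> 0 \<le> killed_shift eps p"
  by (cases p) (simp add: killed_shift_def nonneg)

lemma overshoot_const_denominator_pos:
  "0 < eps \<Longrightarrow> 0 < exp (- \<theta>\<^sub>2 d * (eps / 2)) - exp (- \<theta>\<^sub>1 d * (eps / 2))"
  using roots_sign[of "mu - d"] by (simp add: mult_neg_pos)

lemma overshoot_const_nonneg: "clo \<le> d \<Longrightarrow> d < chi \<Longrightarrow> 0 < eps \<Longrightarrow> 0 \<le> overshoot_const eps d"
  unfolding overshoot_const_def
  using clo_nonneg q_pos by (intro divide_nonneg_pos overshoot_const_denominator_pos) auto

lemma shifted_supporting_solution:
  assumes x: "0 \<le> x" and d: "clo \<le> d" "d < chi" and eps: "0 < eps"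
  obtains A B where "W (x + eps, d) = d / q + A + B" "0 \<le> A" "- overshoot_const eps d \<le> B"
    "\<And>z. - (x + eps) < z \<Longrightarrow> 0 \<le> d / q + A * exp (\<theta>\<^sub>1 d * z) + B * exp (\<theta>\<^sub>2 d * z)"
    "\<And>z. - (x + eps) < z \<Longrightarrow>
      W (x + eps + z, d) \<le> d / q + A * exp (\<theta>\<^sub>1 d * z) + B * exp (\<theta>\<^sub>2 d * z)"
proof -
  obtain A B where touch: "W (x + eps, d) = d / q + A + B"
    and above: "\<And>z. - (x + eps) < z \<Longrightarrow>
      W (x + eps + z, d) \<le> d / q + A * exp (\<theta>\<^sub>1 d * z) + B * exp (\<theta>\<^sub>2 d * z)"
    using supporting_solution[of "x + eps" d] x eps d by auto
  have above_nonneg: "0 \<le> d / q + A * exp (\<theta>\<^sub>1 d * z) + B * exp (\<theta>\<^sub>2 d * z)"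
    if "- (x + eps) < z" for z
    using above[OF that] nonneg[of "x + eps + z" d] that d by auto
  have nonneg_near: "0 \<le> d / q + A * exp (\<theta>\<^sub>1 d * z) + B * exp (\<theta>\<^sub>2 d * z)"
    if "- (eps / 2) \<le> z" for z
    using above_nonneg[of z] that x eps by linarith
  have "0 \<le> A"
    by (rule exp_combination_nonneg_imp_coeff_nonneg[OF roots_sign[of "mu - d"] nonneg_near])
  moreover have "- overshoot_const eps d \<le> B"
    unfolding overshoot_const_def
  proof (rule exp_combination_decaying_coeff_ge[OF roots_sign[of "mu - d"] _ half_gt_zero[OF eps]
        nonneg_near])
    show "0 \<le> d / q" using d clo_nonneg q_pos by simp
    show "d / q + A + B \<le> chi / q" using le_max[of "x + eps" d] touch x d eps by simp
  qed
  ultimately show thesis using touch above above_nonneg that by blast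
qed

lemma killed_shift_le_exp_majorant:
  assumes x: "0 \<le> x" and d: "clo \<le> d" "d < chi" and eps: "0 < eps" and lam: "0 \<le> lam"
  obtains A B where "W (x + eps, d) = d / q + A + B"
    "\<And>z. killed_shift eps (x + z, d) \<le> d / q + A * exp (\<theta>\<^sub>1 d * z) + B * exp (\<theta>\<^sub>2 d * z) +
      overshoot_const eps d * exp (- lam * eps) * exp ((\<theta>\<^sub>2 d - lam) * z)"
proof -
  define K where "K = overshoot_const eps d"
  have K: "0 \<le> K" using overshoot_const_nonneg[OF d eps] by (simp add: K_def)
  obtain A B where touch: "W (x + eps, d) = d / q + A + B" and A: "0 \<le> A" and B: "- K \<le> B"
    and above_nonneg: "\<And>z. - (x + eps) < z \<Longrightarrow> 0 \<le> d / q + A * exp (\<theta>\<^sub>1 d * z) + B * exp (\<theta>\<^sub>2 d * z)"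
    and above: "\<And>z. - (x + eps) < z \<Longrightarrow>
      W (x + eps + z, d) \<le> d / q + A * exp (\<theta>\<^sub>1 d * z) + B * exp (\<theta>\<^sub>2 d * z)"
    using shifted_supporting_solution[OF x d eps] unfolding K_def by metis
  have "killed_shift eps (x + z, d) \<le> d / q + A * exp (\<theta>\<^sub>1 d * z) + B * exp (\<theta>\<^sub>2 d * z) +
      K * exp (- lam * eps) * exp ((\<theta>\<^sub>2 d - lam) * z)" for z
  proof (cases "- (x + eps) < z")
    case True
    have "0 \<le> K * exp (- lam * eps) * exp ((\<theta>\<^sub>2 d - lam) * z)" using K by simp
    then show ?thesis
      using above[OF True] above_nonneg[OF True] by (auto simp: killed_shift_def add_ac)
  next
    case False
    then have z: "z \<le> - eps" and killed: "killed_shift eps (x + z, d) = 0"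
      using x eps by (auto simp: killed_shift_def)
    have "- B * exp (\<theta>\<^sub>2 d * z) \<le> K * exp (\<theta>\<^sub>2 d * z)" using B by (intro mult_right_mono) auto
    also have "\<dots> \<le> K * exp (- lam * eps + (\<theta>\<^sub>2 d - lam) * z)"
      using K mult_left_mono[OF z lam] by (intro mult_left_mono) (auto simp: algebra_simps)
    also have "\<dots> = K * exp (- lam * eps) * exp ((\<theta>\<^sub>2 d - lam) * z)" unfolding exp_add by simp
    finally have "0 \<le> B * exp (\<theta>\<^sub>2 d * z) + K * exp (- lam * eps) * exp ((\<theta>\<^sub>2 d - lam) * z)" by simp
    moreover have "0 \<le> A * exp (\<theta>\<^sub>1 d * z)" using A by simp
    moreover have "0 \<le> d / q" using d clo_nonneg q_pos by simp
    ultimately show ?thesis using killed by linarith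
  qed
  then show thesis by (intro that[OF touch]) (simp add: K_def)
qed

end

section \<open>The Gaussian one-step inequality\<close>

definition centred_gaussian :: "real \<Rightarrow> real measure" where
  "centred_gaussian v = density lborel (normal_density 0 (sqrt v))"

lemma prob_space_centred_gaussian: "0 < v \<Longrightarrow> prob_space (centred_gaussian v)"
  unfolding centred_gaussian_def by (rule prob_space_normal_density) simp

lemma sets_centred_gaussian [simp, measurable_cong]: "sets (centred_gaussian v) = sets borel"
  by (simp add: centred_gaussian_def)

lemma nn_integral_le_if_has_bochner_integral:
  fixes F R :: "'a \<Rightarrow> real"
  assumes R: "has_bochner_integral N R I" and F: "\<And>b. 0 \<le> F b" "\<And>b. F b \<le> R b"
  shows "0 \<le> I" "(\<integral>\<^sup>+ b. ennreal (F b) \<partial>N) \<le> ennreal I"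
proof -
  have R_nonneg: "0 \<le> R b" for b using order_trans[OF F] .
  show "0 \<le> I"
    unfolding has_bochner_integral_integral_eq[OF R, symmetric]
    by (rule Bochner_Integration.integral_nonneg) (rule R_nonneg)
  have "(\<integral>\<^sup>+ b. ennreal (F b) \<partial>N) \<le> (\<integral>\<^sup>+ b. ennreal (R b) \<partial>N)"
    by (intro nn_integral_mono ennreal_leI F)
  also have "\<dots> = ennreal I"
    using R R_nonneg by (subst nn_integral_eq_integral) (auto simp: has_bochner_integral_iff)
  finally show "(\<integral>\<^sup>+ b. ennreal (F b) \<partial>N) \<le> ennreal I" .
qed

lemma has_bochner_integral_centred_gaussian_exp:
  assumes "0 < t"
  shows "has_bochner_integral (centred_gaussian t) (\<lambda>b. exp (r * (m * t + s * b)))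
    (exp (t * (s\<^sup>2 / 2 * r\<^sup>2 + m * r)))"
proof -
  define I where "I = exp (t * (s\<^sup>2 / 2 * r\<^sup>2 + m * r))"
  have "normal_density 0 (sqrt t) b * exp (r * (m * t + s * b)) =
      I * normal_density (r * s * t) (sqrt t) b" for b
  proof -
    have "- b\<^sup>2 / (2 * t) + r * (m * t + s * b) =
        t * (s\<^sup>2 / 2 * r\<^sup>2 + m * r) + - (b - r * s * t)\<^sup>2 / (2 * t)"
      using assms by (simp add: field_simps power2_eq_square)
    then show ?thesis using assms by (simp add: normal_density_def I_def mult_exp_exp)
  qed
  moreover have "has_bochner_integral lborel (\<lambda>b. I * normal_density (r * s * t) (sqrt t) b) (I * 1)"
    using assms by (intro has_bochner_integral_mult_right)
      (auto simp: has_bochner_integral_iff integral_normal_density integrable_normal_density)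
  ultimately show ?thesis
    unfolding centred_gaussian_def I_def by (intro has_bochner_integral_density) simp_all
qed

definition surplus_transition ::
    "real \<Rightarrow> real \<Rightarrow> real \<Rightarrow> (real \<times> real \<Rightarrow> ennreal) \<Rightarrow> real \<times> real \<Rightarrow> ennreal" where
  "surplus_transition mu sig t g =
    (\<lambda>(x, d). \<integral>\<^sup>+ b. g (x + ((mu - d) * t + sig * b), d) \<partial>centred_gaussian t)"

definition annuity :: "real \<Rightarrow> real \<Rightarrow> real" where
  "annuity q t = (1 - exp (- q * t)) / q"

lemma annuity_nonneg: "0 < q \<Longrightarrow> 0 \<le> t \<Longrightarrow> 0 \<le> annuity q t"
  by (simp add: annuity_def)

lemma gaussian_exponent_le:
  fixes r m s t :: real
  assumes t: "0 < t" "t \<le> 1"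
  shows "t * (s\<^sup>2 / 2 * (r - 1 / sqrt t)\<^sup>2 + m * (r - 1 / sqrt t)) \<le>
    s\<^sup>2 / 2 * (\<bar>r\<bar> + 1)\<^sup>2 + \<bar>m\<bar> * (\<bar>r\<bar> + 1)"
proof -
  define u where "u = r - 1 / sqrt t"
  have sqrt_t: "0 < sqrt t" "sqrt t \<le> 1" "sqrt t * sqrt t = t" using t by simp_all
  have "sqrt t * \<bar>u\<bar> \<le> sqrt t * (\<bar>r\<bar> + 1 / sqrt t)"
    using sqrt_t abs_triangle_ineq4[of r "1 / sqrt t"] by (intro mult_left_mono) (auto simp: u_def)
  also have "\<dots> = sqrt t * \<bar>r\<bar> + 1" using sqrt_t by (simp add: distrib_left)
  also have "\<dots> \<le> \<bar>r\<bar> + 1" using sqrt_t by (simp add: mult_left_le_one_le)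
  finally have u_le: "sqrt t * \<bar>u\<bar> \<le> \<bar>r\<bar> + 1" .
  have "t * u\<^sup>2 = (sqrt t * \<bar>u\<bar>)\<^sup>2" using t by (simp add: power_mult_distrib)
  also have "\<dots> \<le> (\<bar>r\<bar> + 1)\<^sup>2" using u_le t by (intro power_mono) auto
  finally have "s\<^sup>2 / 2 * (t * u\<^sup>2) \<le> s\<^sup>2 / 2 * (\<bar>r\<bar> + 1)\<^sup>2" by (intro mult_left_mono) auto
  moreover have "m * (t * u) \<le> \<bar>m\<bar> * (\<bar>r\<bar> + 1)"
  proof -
    have "m * (t * u) \<le> \<bar>m\<bar> * \<bar>t * u\<bar>" unfolding abs_mult[symmetric] by (rule abs_ge_self)
    also have "\<bar>t * u\<bar> = sqrt t * (sqrt t * \<bar>u\<bar>)"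
      using t sqrt_t by (simp add: abs_mult mult.assoc[symmetric])
    also have "\<dots> \<le> 1 * (sqrt t * \<bar>u\<bar>)" using sqrt_t by (intro mult_right_mono) auto
    also have "\<dots> \<le> \<bar>r\<bar> + 1" using u_le by simp
    finally show ?thesis by (simp add: mult_left_mono)
  qed
  ultimately show ?thesis by (simp add: u_def[symmetric] algebra_simps)
qed

context bounded_supersolution
begin

definition overshoot_growth :: "real \<Rightarrow> real" where
  "overshoot_growth d = exp (sig\<^sup>2 / 2 * (\<bar>\<theta>\<^sub>2 d\<bar> + 1)\<^sup>2 + \<bar>mu - d\<bar> * (\<bar>\<theta>\<^sub>2 d\<bar> + 1))"

lemma has_bochner_integral_exp_solution:
  assumes t: "0 < t"
  shows "has_bochner_integral (centred_gaussian t)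
    (\<lambda>b. d / q + A * exp (\<theta>\<^sub>1 d * ((mu - d) * t + sig * b)) +
      B * exp (\<theta>\<^sub>2 d * ((mu - d) * t + sig * b)))
    (d / q + A * exp (t * q) + B * exp (t * q))"
proof -
  interpret gaussian: prob_space "centred_gaussian t" by (rule prob_space_centred_gaussian[OF t])
  have roots: "sig\<^sup>2 / 2 * (\<theta>\<^sub>1 d)\<^sup>2 + (mu - d) * \<theta>\<^sub>1 d = q"
    "sig\<^sup>2 / 2 * (\<theta>\<^sub>2 d)\<^sup>2 + (mu - d) * \<theta>\<^sub>2 d = q"
    using char_roots_equation[OF sig_pos] q_pos by simp_all
  have "has_bochner_integral (centred_gaussian t) (\<lambda>_. d / q) (d / q)"
    by (simp add: has_bochner_integral_iff gaussian.prob_space)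
  then show ?thesis
    using has_bochner_integral_centred_gaussian_exp[OF t, of "\<theta>\<^sub>1 d" "mu - d" sig]
      has_bochner_integral_centred_gaussian_exp[OF t, of "\<theta>\<^sub>2 d" "mu - d" sig]
    unfolding roots by (intro has_bochner_integral_add has_bochner_integral_mult_right)
qed

lemma transition_killed_shift_le:
  assumes x: "0 \<le> x" and d: "clo \<le> d" "d < chi" and eps: "0 < eps" and t: "0 < t" "t \<le> 1"
  obtains I where "0 \<le> I"
    "surplus_transition mu sig t (killed_value eps) (x, d) \<le> ennreal I"
    "d * annuity q t + exp (- q * t) * I \<le>
      W (x + eps, d) + overshoot_const eps d * overshoot_growth d * exp (- eps / sqrt t)"
proof -
  \<comment> \<open>Tilting by \<open>1 / sqrt t\<close> gains \<open>exp (- eps / sqrt t)\<close> on the overshoot at bounded Gaussian cost.\<close>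
  define lam where "lam = 1 / sqrt t"
  define K where "K = overshoot_const eps d * exp (- lam * eps)"
  have K: "0 \<le> K" using overshoot_const_nonneg[OF d eps] by (simp add: K_def)
  obtain A B where touch: "W (x + eps, d) = d / q + A + B"
    and majorant: "\<And>z. killed_shift eps (x + z, d) \<le>
      d / q + A * exp (\<theta>\<^sub>1 d * z) + B * exp (\<theta>\<^sub>2 d * z) + K * exp ((\<theta>\<^sub>2 d - lam) * z)"
    using killed_shift_le_exp_majorant[OF x d eps, of lam] t by (auto simp: lam_def K_def)
  define R where "R = (\<lambda>z. d / q + A * exp (\<theta>\<^sub>1 d * z) + B * exp (\<theta>\<^sub>2 d * z) +
    K * exp ((\<theta>\<^sub>2 d - lam) * z))"
  define \<xi> where "\<xi> = (\<lambda>b. (mu - d) * t + sig * b)"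
  define E where "E = exp (t * (sig\<^sup>2 / 2 * (\<theta>\<^sub>2 d - lam)\<^sup>2 + (mu - d) * (\<theta>\<^sub>2 d - lam)))"
  define I where "I = d / q + A * exp (t * q) + B * exp (t * q) + K * E"
  have R_integral: "has_bochner_integral (centred_gaussian t) (\<lambda>b. R (\<xi> b)) I"
    unfolding R_def I_def \<xi>_def E_def
    by (intro has_bochner_integral_add[OF has_bochner_integral_exp_solution[OF t(1)]]
      has_bochner_integral_mult_right has_bochner_integral_centred_gaussian_exp t)
  note transition_bound = nn_integral_le_if_has_bochner_integral[OF R_integral,
      of "\<lambda>b. killed_shift eps (x + \<xi> b, d)"]
  have "0 \<le> I" "surplus_transition mu sig t (killed_value eps) (x, d) \<le> ennreal I"
    using transition_bound killed_shift_nonneg[of eps] majorant eps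
    by (simp_all add: surplus_transition_def R_def \<xi>_def)
  moreover have "d * annuity q t + exp (- q * t) * I \<le>
      W (x + eps, d) + overshoot_const eps d * overshoot_growth d * exp (- eps / sqrt t)"
  proof -
    have "d * annuity q t + exp (- q * t) * I =
        d / q + exp (- q * t) * exp (t * q) * (A + B) + exp (- q * t) * (K * E)"
      by (simp add: I_def annuity_def diff_divide_distrib algebra_simps)
    also have "\<dots> = W (x + eps, d) + exp (- q * t) * (K * E)" by (simp add: touch mult_exp_exp)
    also have "exp (- q * t) * (K * E) \<le> 1 * (K * overshoot_growth d)"
      using gaussian_exponent_le[OF t, of sig "\<theta>\<^sub>2 d" "mu - d"] q_pos t K
      by (intro mult_mono mult_left_mono) (auto simp: E_def overshoot_growth_def lam_def)
    finally show ?thesis by (simp add: K_def lam_def mult_ac)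
  qed
  ultimately show thesis by (rule that)
qed

lemma overshoot_bounded:
  assumes eps: "0 < eps"
  obtains K where "0 \<le> K" "\<And>d. clo \<le> d \<Longrightarrow> d < chi \<Longrightarrow> overshoot_const eps d * overshoot_growth d \<le> K"
proof -
  have "continuous_on {clo..chi} \<theta>\<^sub>1" "continuous_on {clo..chi} \<theta>\<^sub>2"
    unfolding pos_char_root_def neg_char_root_def using sig_pos by (auto intro!: continuous_intros)
  moreover have "exp (- \<theta>\<^sub>2 d * (eps / 2)) - exp (- \<theta>\<^sub>1 d * (eps / 2)) \<noteq> 0" for d
    using overshoot_const_denominator_pos[OF eps, of d] by linarith
  moreover have "q \<noteq> 0" using q_pos by simp
  ultimately have "continuous_on {clo..chi} (\<lambda>d. overshoot_const eps d * overshoot_growth d)"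
    unfolding overshoot_const_def overshoot_growth_def by (intro continuous_intros ballI)
  then have "bounded ((\<lambda>d. overshoot_const eps d * overshoot_growth d) ` {clo..chi})"
    by (intro compact_imp_bounded compact_continuous_image) auto
  then obtain K where "\<And>d. d \<in> {clo..chi} \<Longrightarrow> \<bar>overshoot_const eps d * overshoot_growth d\<bar> \<le> K"
    unfolding bounded_iff real_norm_def by blast
  then show thesis by (intro that[of "\<bar>K\<bar>"]) force+
qed

lemma discounted_one_step:
  assumes eps: "0 < eps"
  obtains K where "0 \<le> K"
    "\<And>x d t. 0 \<le> x \<Longrightarrow> clo \<le> d \<Longrightarrow> d < chi \<Longrightarrow> 0 < t \<Longrightarrow> t \<le> 1 \<Longrightarrow>
      ennreal (d * annuity q t) +
        ennreal (exp (- q * t)) * surplus_transition mu sig t (killed_value eps) (x, d)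
      \<le> killed_value eps (x, d) + ennreal (K * exp (- eps / sqrt t))"
proof -
  obtain K where K: "0 \<le> K"
    and K_bound: "\<And>d. clo \<le> d \<Longrightarrow> d < chi \<Longrightarrow> overshoot_const eps d * overshoot_growth d \<le> K"
    using overshoot_bounded[OF eps] by blast
  show thesis
  proof (rule that[OF K])
    fix x d t :: real assume x: "0 \<le> x" and d: "clo \<le> d" "d < chi" and t: "0 < t" "t \<le> 1"
    let ?T = "surplus_transition mu sig t (killed_value eps) (x, d)"
    obtain I where I: "0 \<le> I" "?T \<le> ennreal I"
      and step: "d * annuity q t + exp (- q * t) * I \<le>
        W (x + eps, d) + overshoot_const eps d * overshoot_growth d * exp (- eps / sqrt t)"
      using transition_killed_shift_le[OF x d eps t] by blast
    have "0 \<le> d * annuity q t" using d clo_nonneg annuity_nonneg[OF q_pos] t by simp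
    have "ennreal (d * annuity q t) + ennreal (exp (- q * t)) * ?T \<le>
        ennreal (d * annuity q t) + ennreal (exp (- q * t)) * ennreal I"
      using I by (intro add_left_mono mult_left_mono) auto
    also have "\<dots> = ennreal (d * annuity q t + exp (- q * t) * I)"
      using I \<open>0 \<le> d * annuity q t\<close> by (simp add: ennreal_mult ennreal_plus)
    also have "\<dots> \<le> ennreal (W (x + eps, d) + K * exp (- eps / sqrt t))"
      by (intro ennreal_leI order_trans[OF step] add_left_mono mult_right_mono K_bound[OF d]) simp
    also have "\<dots> = killed_value eps (x, d) + ennreal (K * exp (- eps / sqrt t))"
      using nonneg[of "x + eps" d] x d eps K by (simp add: killed_shift_def ennreal_plus)
    finally show "ennreal (d * annuity q t) + ennreal (exp (- q * t)) * ?T \<le>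
        killed_value eps (x, d) + ennreal (K * exp (- eps / sqrt t))" .
  qed
qed

end

section \<open>Brownian increments and the completed filtration\<close>

lemma Int_stable_vimage_sets: "Int_stable {f -` A \<inter> \<Omega> | A. A \<in> sets N}"
proof (rule Int_stableI)
  fix E F assume "E \<in> {f -` A \<inter> \<Omega> | A. A \<in> sets N}" "F \<in> {f -` A \<inter> \<Omega> | A. A \<in> sets N}"
  then obtain A A' where sets: "A \<in> sets N" "A' \<in> sets N" and "E = f -` A \<inter> \<Omega>" "F = f -` A' \<inter> \<Omega>"
    by blast
  then have "E \<inter> F = f -` (A \<inter> A') \<inter> \<Omega>" by auto
  with sets show "E \<inter> F \<in> {f -` A \<inter> \<Omega> | A. A \<in> sets N}" by blast
qed

lemma finite_set_strict_mono_enumeration: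
  fixes J :: "real set"
  assumes "finite J"
  obtains ts :: "nat \<Rightarrow> real" and n where "strict_mono ts" "J = ts ` {..<n}"
proof -
  define xs where "xs = sorted_list_of_set J"
  define n where "n = card J"
  define ts where "ts = (\<lambda>i. if i < n then xs ! i else Max (insert 0 J) + 1 + real i)"
  have xs: "set xs = J" "length xs = n" "sorted_wrt (<) xs"
    using assms by (simp_all add: xs_def n_def)
  have "strict_mono ts"
    unfolding strict_mono_Suc_iff
  proof
    fix i
    consider (inside) "Suc i < n" | (last) "Suc i = n" | (beyond) "n \<le> i" by linarith
    then show "ts i < ts (Suc i)"
    proof cases
      case inside
      then show ?thesis
        using sorted_wrt_nth_less[OF xs(3), of i "Suc i"] xs(2) by (simp add: ts_def)
    next
      case last
      then have "xs ! i \<in> J" using xs(1,2) nth_mem[of i xs] by simp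
      then have "xs ! i \<le> Max (insert 0 J)" using assms by simp
      then show ?thesis using last by (simp add: ts_def)
    qed (simp add: ts_def)
  qed
  moreover have "J = ts ` {..<n}"
  proof -
    have "J = (!) xs ` {..<n}" using xs(1,2) by (auto simp: set_conv_nth)
    also have "\<dots> = ts ` {..<n}" by (intro image_cong) (simp_all add: ts_def)
    finally show ?thesis .
  qed
  ultimately show thesis by (rule that)
qed

lemma finite_times_strict_mono_extension:
  fixes J :: "real set"
  assumes J: "finite J" "J \<subseteq> {0..T}" and T: "0 \<le> T" and t: "0 < t"
  obtains ts :: "nat \<Rightarrow> real" and n where "strict_mono ts" "ts 0 = 0" "ts n = T" "ts (Suc n) = T + t"
    "J \<subseteq> ts ` {..n}"
proof -
  define J' where "J' = insert 0 (insert T (insert (T + t) J))"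
  obtain ts :: "nat \<Rightarrow> real" and N where ts: "strict_mono ts" "J' = ts ` {..<N}"
    by (rule finite_set_strict_mono_enumeration[of J']) (use J in \<open>auto simp: J'_def\<close>)
  have less: "ts i < ts j \<longleftrightarrow> i < j" for i j by (rule strict_mono_less[OF ts(1)])
  have "0 \<in> ts ` {..<N}" "T \<in> ts ` {..<N}" "T + t \<in> ts ` {..<N}"
    unfolding ts(2)[symmetric] by (simp_all add: J'_def)
  then obtain i0 n m where idx: "ts i0 = 0" "ts n = T" "ts m = T + t" "m < N"
    by (metis imageE lessThan_iff)
  have range: "ts i = T + t \<or> ts i \<in> {0..T}" if "i < N" for i
  proof -
    have "ts i \<in> J'" using that ts(2) by simp
    then show ?thesis using J T by (auto simp: J'_def)
  qed
  have "i0 = 0"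
    using range[of 0] idx less[of 0 i0] t T by (cases "i0 = 0") auto
  have "n < m" using idx t less[of n m] by simp
  then have "ts (Suc n) = T + t"
    using range[of "Suc n"] idx less[of n "Suc n"] by auto
  moreover have "J \<subseteq> ts ` {..n}"
  proof
    fix s assume s: "s \<in> J"
    then obtain i where i: "s = ts i" using ts(2) by (auto simp: J'_def)
    then have "i \<le> n" using s J idx(2) less[of n i] by (auto simp: not_less[symmetric])
    then show "s \<in> ts ` {..n}" using i by simp
  qed
  ultimately show thesis using that[of ts n] ts(1) idx \<open>i0 = 0\<close> by simp
qed

lemma measurable_partial_sums:
  fixes k :: "'i \<Rightarrow> nat"
  assumes "\<And>s. s \<in> J \<Longrightarrow> k s \<le> n"
  shows "(\<lambda>f. \<lambda>s\<in>J. \<Sum>i<k s. f i :: real) \<in> PiM {..<n} (\<lambda>_. borel) \<rightarrow>\<^sub>M PiM J (\<lambda>_. borel)"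
proof (rule measurable_restrict)
  show "(\<lambda>f. \<Sum>i<k s. f i :: real) \<in> borel_measurable (PiM {..<n} (\<lambda>_. borel))" if "s \<in> J" for s
    by (intro borel_measurable_sum[of "{..<k s}" "\<lambda>i f. f i"] measurable_component_singleton)
      (use assms[OF that] in simp)
qed

lemma space_filt: "space (filt M X T) = space M"
  unfolding filt_def by (rule space_measure_of) auto

lemma sets_filt:
  "sets (filt M X T) = sigma_sets (space M)
    ({X s -` A \<inter> space M | s A. 0 \<le> s \<and> s \<le> T \<and> A \<in> sets borel} \<union>
      {N. N \<subseteq> space M \<and> (\<exists>A\<in>null_sets M. N \<subseteq> A)})"
  unfolding filt_def by (rule sets_measure_of) auto

locale brownian_motion =
  fixes M :: "'a measure" and B :: "real \<Rightarrow> 'a \<Rightarrow> real"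
  assumes std_BM: "std_BM M B"
begin

sublocale prob_space M
  using std_BM by (simp add: std_BM_def)

sublocale completed: prob_space "completion M"
  by (rule prob_space_completion)

lemma random_variable_B [measurable]: "B s \<in> borel_measurable M"
  using std_BM by (simp add: std_BM_def)

lemma B_0: "\<omega> \<in> space M \<Longrightarrow> B 0 \<omega> = 0"
  using std_BM by (simp add: std_BM_def)

abbreviation past :: "real set \<Rightarrow> 'a \<Rightarrow> real \<Rightarrow> real" where
  "past J \<omega> \<equiv> \<lambda>s\<in>J. B s \<omega>"

abbreviation increment :: "real \<Rightarrow> real \<Rightarrow> 'a \<Rightarrow> real" where
  "increment T t \<omega> \<equiv> B (T + t) \<omega> - B T \<omega>"

lemma random_variable_increment: "increment T t \<in> borel_measurable (completion M)"
  by (rule measurable_completion) measurable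

lemma distr_increment:
  assumes "0 \<le> T" "0 < t"
  shows "distr (completion M) borel (increment T t) = centred_gaussian t"
proof -
  have "distr (completion M) borel (increment T t) = distr M lborel (increment T t)"
    by (subst distr_completion) (auto intro!: distr_cong)
  moreover have "distributed M lborel (increment T t) (normal_density 0 (sqrt (T + t - T)))"
    using std_BM assms unfolding std_BM_def by (metis less_add_same_cancel1)
  ultimately show ?thesis
    by (simp add: centred_gaussian_def distributed_distr_eq_density)
qed

lemma partial_sums_increments_eq_past:
  assumes ts: "ts 0 = 0" and k: "\<And>s. s \<in> J \<Longrightarrow> k s \<le> n" "\<And>s. s \<in> J \<Longrightarrow> ts (k s) = s"
    and \<omega>: "\<omega> \<in> space M"
  shows "(\<lambda>s\<in>J. \<Sum>i<k s. (\<lambda>i\<in>{..<n}. B (ts (Suc i)) \<omega> - B (ts i) \<omega>) i) = past J \<omega>"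
proof (rule restrict_ext)
  fix s assume s: "s \<in> J"
  have "(\<Sum>i<k s. (\<lambda>i\<in>{..<n}. B (ts (Suc i)) \<omega> - B (ts i) \<omega>) i) =
      (\<Sum>i<k s. B (ts (Suc i)) \<omega> - B (ts i) \<omega>)"
    using k(1)[OF s] by (intro sum.cong) auto
  also have "\<dots> = B (ts (k s)) \<omega> - B (ts 0) \<omega>"
    by (rule sum_lessThan_telescope)
  finally show "(\<Sum>i<k s. (\<lambda>i\<in>{..<n}. B (ts (Suc i)) \<omega> - B (ts i) \<omega>) i) = B s \<omega>"
    using k(2)[OF s] ts B_0[OF \<omega>] by simp
qed

lemma prob_past_Int_increment:
  assumes J: "finite J" "J \<subseteq> {0..T}" and T: "0 \<le> T" and t: "0 < t"
    and S: "S \<in> sets (PiM J (\<lambda>_. borel))" and A: "A \<in> sets borel"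
  shows "prob ((past J -` S \<inter> space M) \<inter> (increment T t -` A \<inter> space M)) =
    prob (past J -` S \<inter> space M) * prob (increment T t -` A \<inter> space M)"
proof -
  obtain ts n where ts: "strict_mono ts" "ts 0 = 0" "ts n = T" "ts (Suc n) = T + t"
    and J_range: "J \<subseteq> ts ` {..n}"
    using finite_times_strict_mono_extension[OF J T t] by blast
  have "\<forall>s\<in>J. \<exists>k\<le>n. ts k = s" using J_range by auto
  then obtain k where k: "\<And>s. s \<in> J \<Longrightarrow> k s \<le> n" "\<And>s. s \<in> J \<Longrightarrow> ts (k s) = s"
    by metis
  define Z where "Z = (\<lambda>i \<omega>. B (ts (Suc i)) \<omega> - B (ts i) \<omega>)"
  have "indep_vars (\<lambda>_. borel) Z {..<Suc n}"
    using std_BM ts(1,2) by (auto simp: std_BM_def Z_def)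
  then have indep: "indep_var (PiM {..<n} (\<lambda>_. borel)) (\<lambda>\<omega>. \<lambda>i\<in>{..<n}. Z i \<omega>)
      (PiM {n} (\<lambda>_. borel)) (\<lambda>\<omega>. \<lambda>i\<in>{n}. Z i \<omega>)"
    by (rule indep_var_restrict) auto
  define S' where "S' = (\<lambda>f. \<lambda>s\<in>J. \<Sum>i<k s. f i) -` S \<inter> space (PiM {..<n} (\<lambda>_. borel))"
  define A' where "A' = (\<lambda>f. f n) -` A \<inter> space (PiM {n} (\<lambda>_. borel :: real measure))"
  have sets: "S' \<in> sets (PiM {..<n} (\<lambda>_. borel))" "A' \<in> sets (PiM {n} (\<lambda>_. borel))"
    unfolding S'_def A'_def using S A k(1)
    by (auto intro: measurable_sets measurable_partial_sums measurable_component_singleton)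
  have "(\<lambda>i\<in>{..<n}. Z i \<omega>) \<in> S' \<longleftrightarrow> past J \<omega> \<in> S" if "\<omega> \<in> space M" for \<omega>
    using partial_sums_increments_eq_past[OF ts(2) k that] by (simp add: S'_def Z_def space_PiM)
  moreover have "(\<lambda>i\<in>{n}. Z i \<omega>) \<in> A' \<longleftrightarrow> increment T t \<omega> \<in> A" for \<omega>
    using ts by (simp add: Z_def A'_def space_PiM)
  ultimately have "(\<lambda>\<omega>. (\<lambda>i\<in>{..<n}. Z i \<omega>, \<lambda>i\<in>{n}. Z i \<omega>)) -` (S' \<times> A') \<inter> space M =
      (past J -` S \<inter> space M) \<inter> (increment T t -` A \<inter> space M)"
    "(\<lambda>\<omega>. \<lambda>i\<in>{..<n}. Z i \<omega>) -` S' \<inter> space M = past J -` S \<inter> space M"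
    "(\<lambda>\<omega>. \<lambda>i\<in>{n}. Z i \<omega>) -` A' \<inter> space M = increment T t -` A \<inter> space M"
    by auto
  with indep_varD[OF indep sets] show ?thesis by simp
qed

text \<open>The filtration is completed, so the cylinders themselves generate it only up to null sets.\<close>

definition almost_cylinders :: "real \<Rightarrow> 'a set set" where
  "almost_cylinders T = {E. E \<subseteq> space M \<and>
     (\<exists>J S. finite J \<and> J \<subseteq> {0..T} \<and> S \<in> sets (PiM J (\<lambda>_. borel)) \<and>
       (AE \<omega> in M. \<omega> \<in> E \<longleftrightarrow> past J \<omega> \<in> S))}"

lemma almost_cylindersI:
  assumes "E \<subseteq> space M" "finite J" "J \<subseteq> {0..T}" "S \<in> sets (PiM J (\<lambda>_. borel))"
    "AE \<omega> in M. \<omega> \<in> E \<longleftrightarrow> past J \<omega> \<in> S"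
  shows "E \<in> almost_cylinders T"
  using assms unfolding almost_cylinders_def by blast

lemma Int_stable_almost_cylinders: "Int_stable (almost_cylinders T)"
proof (rule Int_stableI)
  fix E1 E2 assume "E1 \<in> almost_cylinders T" "E2 \<in> almost_cylinders T"
  then obtain J1 S1 J2 S2 where E: "E1 \<subseteq> space M" "E2 \<subseteq> space M"
    and J: "finite J1" "J1 \<subseteq> {0..T}" "finite J2" "J2 \<subseteq> {0..T}"
    and S: "S1 \<in> sets (PiM J1 (\<lambda>_. borel))" "S2 \<in> sets (PiM J2 (\<lambda>_. borel))"
    and ae: "AE \<omega> in M. \<omega> \<in> E1 \<longleftrightarrow> past J1 \<omega> \<in> S1"
      "AE \<omega> in M. \<omega> \<in> E2 \<longleftrightarrow> past J2 \<omega> \<in> S2"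
    unfolding almost_cylinders_def by blast
  let ?P = "PiM (J1 \<union> J2) (\<lambda>_. borel :: real measure)"
  define S where "S = ((\<lambda>f. restrict f J1) -` S1 \<inter> space ?P) \<inter> ((\<lambda>f. restrict f J2) -` S2 \<inter> space ?P)"
  have S_sets: "S \<in> sets ?P"
    unfolding S_def by (intro sets.Int measurable_sets[OF measurable_restrict_subset] S) auto
  have "(J1 \<union> J2) \<inter> J1 = J1" "(J1 \<union> J2) \<inter> J2 = J2" by auto
  then have "past (J1 \<union> J2) \<omega> \<in> S \<longleftrightarrow>
      past J1 \<omega> \<in> S1 \<and> past J2 \<omega> \<in> S2" for \<omega>
    by (simp add: S_def space_PiM)
  with ae have "AE \<omega> in M. \<omega> \<in> E1 \<inter> E2 \<longleftrightarrow> past (J1 \<union> J2) \<omega> \<in> S"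
    by auto
  with S_sets show "E1 \<inter> E2 \<in> almost_cylinders T"
    using E J by (intro almost_cylindersI) auto
qed

lemma sets_filt_subset:
  "sets (filt M (Xproc mu sig B x) T) \<subseteq> sigma_sets (space M) (almost_cylinders T)"
proof -
  have "Xproc mu sig B x s -` A \<inter> space M \<in> almost_cylinders T"
    if s: "0 \<le> s" "s \<le> T" and A: "A \<in> sets borel" for s A
  proof (rule almost_cylindersI)
    let ?S = "(\<lambda>f. x + mu * s + sig * f s) -` A \<inter> space (PiM {s} (\<lambda>_. borel :: real measure))"
    show "?S \<in> sets (PiM {s} (\<lambda>_. borel))"
      using A by measurable
    show "AE \<omega> in M. \<omega> \<in> Xproc mu sig B x s -` A \<inter> space M \<longleftrightarrow> past {s} \<omega> \<in> ?S"
      by (rule AE_I2) (simp add: Xproc_def space_PiM B_0)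
  qed (use s in auto)
  moreover have "N \<in> almost_cylinders T" if "N \<subseteq> space M" "A \<in> null_sets M" "N \<subseteq> A" for N A
  proof (rule almost_cylindersI)
    show "AE \<omega> in M. \<omega> \<in> N \<longleftrightarrow> past {} \<omega> \<in> {}"
      using AE_not_in[OF that(2)] that(3) by auto
  qed (use that in auto)
  ultimately have "{Xproc mu sig B x s -` A \<inter> space M | s A. 0 \<le> s \<and> s \<le> T \<and> A \<in> sets borel} \<union>
      {N. N \<subseteq> space M \<and> (\<exists>A\<in>null_sets M. N \<subseteq> A)} \<subseteq> almost_cylinders T"
    by auto
  then show ?thesis
    unfolding sets_filt by (rule sigma_sets_mono')
qed

lemma almost_cylindersE:
  assumes "E \<in> almost_cylinders T"
  obtains J S where "finite J" "J \<subseteq> {0..T}" "S \<in> sets (PiM J (\<lambda>_. borel))" "E \<in> sets (completion M)"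
    "\<And>F. F \<in> sets M \<Longrightarrow> completed.prob (E \<inter> F) = prob (past J -` S \<inter> space M \<inter> F)"
proof -
  obtain J S where E: "E \<subseteq> space M" and J: "finite J" "J \<subseteq> {0..T}"
    and S: "S \<in> sets (PiM J (\<lambda>_. borel))"
    and ae: "AE \<omega> in M. \<omega> \<in> E \<longleftrightarrow> past J \<omega> \<in> S"
    using assms unfolding almost_cylinders_def by blast
  have past_sets: "past J -` S \<inter> space M \<in> sets M"
    by (intro measurable_sets[OF measurable_restrict S]) simp
  have ae': "AE \<omega> in completion M. \<omega> \<in> past J -` S \<inter> space M \<longleftrightarrow> \<omega> \<in> E"
    using AE_completion[OF ae] AE_space by eventually_elim auto
  have E_sets: "E \<in> sets (completion M)"
    using completion.in_sets_AE[OF ae'] past_sets E by simp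
  have "completed.prob (E \<inter> F) = prob (past J -` S \<inter> space M \<inter> F)" if F: "F \<in> sets M" for F
  proof -
    have "completed.prob (E \<inter> F) = completed.prob (past J -` S \<inter> space M \<inter> F)"
      using ae' E_sets past_sets F by (intro completed.finite_measure_eq_AE) auto
    then show ?thesis using past_sets F by simp
  qed
  with J S E_sets show thesis by (rule that)
qed

lemma indep_filt_increment:
  assumes T: "0 \<le> T" and t: "0 < t"
  shows "completed.indep_set (sets (filt M (Xproc mu sig B x) T))
    {increment T t -` A \<inter> space M | A. A \<in> sets borel}"
proof -
  let ?Inc = "{increment T t -` A \<inter> space M | A. A \<in> sets borel}"
  have inc_sets: "F \<in> sets M" if "F \<in> ?Inc" for F
    using that by auto
  have "completed.indep_set (almost_cylinders T) ?Inc"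
  proof (rule completed.indep_setI)
    show "almost_cylinders T \<subseteq> completed.events"
      by (auto elim: almost_cylindersE)
    show "?Inc \<subseteq> completed.events" using inc_sets by blast
    fix E F assume almost_cylinder: "E \<in> almost_cylinders T" and F: "F \<in> ?Inc"
    obtain J S where J: "finite J" "J \<subseteq> {0..T}" and S: "S \<in> sets (PiM J (\<lambda>_. borel))"
      and E: "E \<in> sets (completion M)"
        "\<And>F. F \<in> sets M \<Longrightarrow> completed.prob (E \<inter> F) = prob (past J -` S \<inter> space M \<inter> F)"
      by (rule almost_cylindersE[OF almost_cylinder]) (rule that)
    have "completed.prob E = prob (past J -` S \<inter> space M)"
      using E(2)[OF sets.top] sets.sets_into_space[OF E(1)] by (simp add: Int_absorb2)
    moreover have "completed.prob F = prob F" using inc_sets[OF F] by simp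
    moreover have "prob (past J -` S \<inter> space M \<inter> F) = prob (past J -` S \<inter> space M) * prob F"
      using F prob_past_Int_increment[OF J T t S] by auto
    ultimately show "completed.prob (E \<inter> F) = completed.prob E * completed.prob F"
      using E(2)[OF inc_sets[OF F]] by simp
  qed
  then have indep:
    "completed.indep_set (sigma_sets (space M) (almost_cylinders T)) (sigma_sets (space M) ?Inc)"
    using completed.indep_set_sigma_sets[OF _ Int_stable_almost_cylinders Int_stable_vimage_sets]
    by simp
  show ?thesis
  proof (rule completed.indep_setI)
    show "sets (filt M (Xproc mu sig B x) T) \<subseteq> completed.events"
      using sets_filt_subset completed.indep_setD_ev1[OF indep] by (rule subset_trans)
    show "?Inc \<subseteq> completed.events" using inc_sets by blast
    fix E F assume "E \<in> sets (filt M (Xproc mu sig B x) T)" "F \<in> ?Inc"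
    then show "completed.prob (E \<inter> F) = completed.prob E * completed.prob F"
      by (intro completed.indep_setD[OF indep] sigma_sets.Basic subsetD[OF sets_filt_subset])
  qed
qed

lemma measurable_filt_completion:
  assumes T: "0 \<le> T" and Y: "Y \<in> filt M (Xproc mu sig B x) T \<rightarrow>\<^sub>M N"
  shows "Y \<in> completion M \<rightarrow>\<^sub>M N"
proof -
  have "sets (filt M (Xproc mu sig B x) T) \<subseteq> sets (completion M)"
    using completed.indep_setD_ev1[OF indep_filt_increment[OF T zero_less_one]] .
  then show ?thesis using Y unfolding measurable_def space_filt space_completion by blast
qed

lemma measurable_filt_mono:
  assumes "s \<le> T" "Y \<in> filt M X s \<rightarrow>\<^sub>M N"
  shows "Y \<in> filt M X T \<rightarrow>\<^sub>M N"
proof -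
  have "sets (filt M X s) \<subseteq> sets (filt M X T)"
    unfolding sets_filt using assms(1) by (intro sigma_sets_mono' Un_mono) force+
  then show ?thesis using assms(2) unfolding measurable_def space_filt by blast
qed

lemma measurable_filt_process:
  assumes "0 \<le> s" "s \<le> T"
  shows "X s \<in> borel_measurable (filt M X T)"
  by (rule measurableI) (use assms in \<open>auto simp: space_filt sets_filt intro!: sigma_sets.Basic\<close>)

lemma distr_filt_increment:
  assumes T: "0 \<le> T" and t: "0 < t" and Y: "Y \<in> filt M (Xproc mu sig B x) T \<rightarrow>\<^sub>M N"
  shows "distr (completion M) N Y \<Otimes>\<^sub>M centred_gaussian t =
    distr (completion M) (N \<Otimes>\<^sub>M borel) (\<lambda>\<omega>. (Y \<omega>, increment T t \<omega>))"
proof -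
  let ?Y = "distr (completion M) N Y"
  have Y': "Y \<in> completion M \<rightarrow>\<^sub>M N" by (rule measurable_filt_completion[OF T Y])
  interpret gaussian: prob_space "centred_gaussian t" by (rule prob_space_centred_gaussian[OF t])
  interpret Y: prob_space ?Y by (rule completed.prob_space_distr[OF Y'])
  show ?thesis
  proof (rule pair_measure_eqI)
    fix E A assume "E \<in> sets ?Y" and "A \<in> sets (centred_gaussian t)"
    then have E: "E \<in> sets N" and A: "A \<in> sets borel" by simp_all
    have "Y -` E \<inter> space M \<in> sets (filt M (Xproc mu sig B x) T)"
      using measurable_sets[OF Y E] by (simp add: space_filt)
    then have "completed.prob ((Y -` E \<inter> space M) \<inter> (increment T t -` A \<inter> space M)) =
        completed.prob (Y -` E \<inter> space M) * completed.prob (increment T t -` A \<inter> space M)"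
      using A by (intro completed.indep_setD[OF indep_filt_increment[OF T t]]) auto
    moreover have "(Y -` E \<inter> space M) \<inter> (increment T t -` A \<inter> space M) =
        (\<lambda>\<omega>. (Y \<omega>, increment T t \<omega>)) -` (E \<times> A) \<inter> space (completion M)"
      by auto
    ultimately show "emeasure ?Y E * emeasure (centred_gaussian t) A =
        emeasure (distr (completion M) (N \<Otimes>\<^sub>M borel) (\<lambda>\<omega>. (Y \<omega>, increment T t \<omega>))) (E \<times> A)"
      using Y' random_variable_increment E A
      by (simp add: distr_increment[OF T t, symmetric] emeasure_distr
        completed.emeasure_eq_measure ennreal_mult)
  next
    show "sets (?Y \<Otimes>\<^sub>M centred_gaussian t) =
        sets (distr (completion M) (N \<Otimes>\<^sub>M borel) (\<lambda>\<omega>. (Y \<omega>, increment T t \<omega>)))"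
      unfolding sets_distr by (intro sets_pair_measure_cong) simp_all
  qed (rule Y.sigma_finite_measure_axioms gaussian.sigma_finite_measure_axioms)+
qed

lemma nn_integral_filt_increment:
  assumes T: "0 \<le> T" and t: "0 < t"
    and Y: "Y \<in> filt M (Xproc mu sig B x) T \<rightarrow>\<^sub>M N" and f: "f \<in> borel_measurable (N \<Otimes>\<^sub>M borel)"
  shows "(\<integral>\<^sup>+ \<omega>. f (Y \<omega>, increment T t \<omega>) \<partial>completion M) =
    (\<integral>\<^sup>+ \<omega>. (\<integral>\<^sup>+ b. f (Y \<omega>, b) \<partial>centred_gaussian t) \<partial>completion M)"
proof -
  interpret gaussian: prob_space "centred_gaussian t" by (rule prob_space_centred_gaussian[OF t])
  have Y': "Y \<in> completion M \<rightarrow>\<^sub>M N" by (rule measurable_filt_completion[OF T Y])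
  have "(\<integral>\<^sup>+ \<omega>. f (Y \<omega>, increment T t \<omega>) \<partial>completion M) =
      (\<integral>\<^sup>+ z. f z \<partial>(distr (completion M) N Y \<Otimes>\<^sub>M centred_gaussian t))"
    unfolding distr_filt_increment[OF T t Y]
    using Y' random_variable_increment f by (simp add: nn_integral_distr)
  also have "\<dots> = (\<integral>\<^sup>+ y. \<integral>\<^sup>+ b. f (y, b) \<partial>centred_gaussian t \<partial>distr (completion M) N Y)"
    using f by (intro gaussian.nn_integral_fst[symmetric]) simp
  also have "\<dots> = (\<integral>\<^sup>+ \<omega>. (\<integral>\<^sup>+ b. f (Y \<omega>, b) \<partial>centred_gaussian t) \<partial>completion M)"
    using Y' f gaussian.borel_measurable_nn_integral_fst[of f N] by (subst nn_integral_distr) auto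
  finally show ?thesis .
qed

lemma nn_integral_surplus_transition:
  fixes Z :: "'a \<Rightarrow> ennreal" and X D :: "'a \<Rightarrow> real"
  assumes T: "0 \<le> T" and t: "0 < t"
    and Z: "Z \<in> borel_measurable (filt M (Xproc mu sig B x) T)"
    and X: "X \<in> borel_measurable (filt M (Xproc mu sig B x) T)"
    and D: "D \<in> borel_measurable (filt M (Xproc mu sig B x) T)"
    and g [measurable]: "g \<in> borel_measurable borel"
  shows "(\<integral>\<^sup>+ \<omega>. Z \<omega> * g (X \<omega> + ((mu - D \<omega>) * t + sig * increment T t \<omega>), D \<omega>) \<partial>completion M) =
    (\<integral>\<^sup>+ \<omega>. Z \<omega> * surplus_transition mu sig t g (X \<omega>, D \<omega>) \<partial>completion M)"
proof -
  define f :: "(ennreal \<times> real \<times> real) \<times> real \<Rightarrow> ennreal" where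
    "f = (\<lambda>((z, x, d), b). z * g (x + ((mu - d) * t + sig * b), d))"
  have "f \<in> borel_measurable ((borel \<Otimes>\<^sub>M borel \<Otimes>\<^sub>M borel) \<Otimes>\<^sub>M borel)"
    unfolding f_def case_prod_unfold by measurable
  moreover have "(\<lambda>\<omega>. (Z \<omega>, X \<omega>, D \<omega>)) \<in> filt M (Xproc mu sig B x) T \<rightarrow>\<^sub>M borel \<Otimes>\<^sub>M borel \<Otimes>\<^sub>M borel"
    by (intro measurable_Pair Z X D)
  ultimately have "(\<integral>\<^sup>+ \<omega>. f ((Z \<omega>, X \<omega>, D \<omega>), increment T t \<omega>) \<partial>completion M) =
      (\<integral>\<^sup>+ \<omega>. (\<integral>\<^sup>+ b. f ((Z \<omega>, X \<omega>, D \<omega>), b) \<partial>centred_gaussian t) \<partial>completion M)"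
    by (intro nn_integral_filt_increment[OF T t])
  then show ?thesis
    by (simp add: f_def surplus_transition_def nn_integral_cmult)
qed

end

section \<open>Payoffs along a time grid\<close>

definition path_ruin_time :: "(real \<Rightarrow> real) \<Rightarrow> (real \<Rightarrow> real) \<Rightarrow> ereal" where
  "path_ruin_time y C = Inf {ereal t | t. 0 \<le> t \<and> y t - integral {0..t} C < 0}"

definition path_payoff :: "real \<Rightarrow> (real \<Rightarrow> real) \<Rightarrow> (real \<Rightarrow> real) \<Rightarrow> ennreal" where
  "path_payoff q y C = (\<integral>\<^sup>+ s. indicator {s. 0 \<le> s \<and> ereal s < path_ruin_time y C} s *
     ennreal (exp (- q * s) * C s) \<partial>lborel)"

lemma Jval_eq_path_payoff:
  "Jval M mu sig q B x C = enn2real (\<integral>\<^sup>+ \<omega>. path_payoff q (\<lambda>t. Xproc mu sig B x t \<omega>) (\<lambda>t. C t \<omega>) \<partial>M)"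
  by (simp add: Jval_def ruin_time_def surplus_def path_payoff_def path_ruin_time_def)

lemma path_payoff_le:
  assumes q: "0 < q" and C: "\<And>s. 0 \<le> s \<Longrightarrow> C s \<le> chi" and chi: "0 \<le> chi"
  shows "path_payoff q y C \<le> ennreal (chi / q)"
proof -
  have "path_payoff q y C \<le> (\<integral>\<^sup>+ s. ennreal (chi * exp (- q * s)) * indicator {0..} s \<partial>lborel)"
    unfolding path_payoff_def using C
    by (intro nn_integral_mono) (auto simp: indicator_def mult.commute intro!: ennreal_leI)
  also have "\<dots> = ennreal (0 - - (chi / q) * exp (- q * 0))"
  proof (rule nn_integral_FTC_atLeast)
    show "((\<lambda>s. - (chi / q) * exp (- q * s)) \<longlongrightarrow> 0) at_top"
      using q by (intro tendsto_mult_right_zero filterlim_compose[OF exp_at_bot]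
        filterlim_tendsto_neg_mult_at_bot[OF tendsto_const _ filterlim_ident]) simp
  qed (use q chi in \<open>auto intro!: derivative_eq_intros\<close>)
  finally show ?thesis by simp
qed

lemma annuity_le: "0 < q \<Longrightarrow> annuity q t \<le> t"
  using exp_ge_add_one_self[of "- q * t"] by (simp add: annuity_def divide_simps mult.commute)

lemma nn_integral_exp_grid:
  assumes q: "0 < q" and t: "0 < t"
  shows "(\<integral>\<^sup>+ s. ennreal (exp (- q * s)) * indicator {real k * t..real (Suc k) * t} s \<partial>lborel) =
    ennreal (exp (- q * t) ^ k * annuity q t)"
proof -
  have "(\<integral>\<^sup>+ s. ennreal (exp (- q * s)) * indicator {real k * t..real (Suc k) * t} s \<partial>lborel) =
      ennreal (- exp (- q * (real (Suc k) * t)) / q - - exp (- q * (real k * t)) / q)"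
    using q t
    by (intro nn_integral_FTC_Icc) (auto intro!: derivative_eq_intros simp: mult_right_mono)
  also have "exp (- q * (real k * t)) = exp (- q * t) ^ k"
    by (simp add: exp_of_nat_mult[symmetric] algebra_simps)
  also have "exp (- q * (real (Suc k) * t)) = exp (- q * t) * exp (- q * t) ^ k"
    by (simp add: exp_of_nat_mult[symmetric] mult_exp_exp algebra_simps)
  finally show ?thesis by (simp add: annuity_def diff_divide_distrib algebra_simps)
qed

lemma suminf_discounted_annuity:
  assumes q: "0 < q" and t: "0 < t"
  shows "(\<Sum>k. ennreal (exp (- q * t) ^ k * annuity q t)) = ennreal (1 / q)"
proof (rule suminf_ennreal_eq)
  have "(\<lambda>k. exp (- q * t) ^ k * annuity q t) sums (1 / (1 - exp (- q * t)) * annuity q t)"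
    using q t by (intro sums_mult2 geometric_sums) simp
  then show "(\<lambda>k. exp (- q * t) ^ k * annuity q t) sums (1 / q)"
    using q t by (simp add: annuity_def)
qed (use q t annuity_nonneg[of q t] in simp)

lemma suminf_ennreal_increments_le:
  fixes c :: "nat \<Rightarrow> real"
  assumes "incseq c" "\<And>k. c k - c 0 \<le> u"
  shows "(\<Sum>k. ennreal (c (Suc k) - c k)) \<le> ennreal u"
  unfolding suminf_eq_SUP
proof (rule SUP_least)
  fix n
  have "(\<Sum>k<n. ennreal (c (Suc k) - c k)) = ennreal (\<Sum>k<n. c (Suc k) - c k)"
    using assms(1) by (intro sum_ennreal) (simp add: incseq_SucD)
  also have "\<dots> \<le> ennreal u"
    unfolding sum_lessThan_telescope by (intro ennreal_leI assms(2))
  finally show "(\<Sum>k<n. ennreal (c (Suc k) - c k)) \<le> ennreal u" .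
qed

lemma discounted_freezing_error_le:
  fixes c :: "nat \<Rightarrow> real"
  assumes q: "0 < q" and t: "0 < t" and de: "0 \<le> de"
    and c: "incseq c" "\<And>k. 0 \<le> c k" "\<And>k. c k \<le> chi"
  shows "(\<Sum>k. ennreal (exp (- q * t) ^ k * annuity q t) * ennreal (de + (c (Suc k) - c k)))
    \<le> ennreal (de / q + t * chi)"
proof -
  define w where "w = (\<lambda>k. exp (- q * t) ^ k * annuity q t)"
  have incr: "0 \<le> c (Suc k) - c k" for k using c(1) by (simp add: incseq_SucD)
  have w_le: "w k \<le> t" for k
  proof -
    have "w k \<le> 1 * annuity q t"
      unfolding w_def using q t annuity_nonneg[of q t] by (intro mult_right_mono power_le_one) auto
    then show ?thesis using annuity_le[OF q, of t] by simp
  qed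
  have "(\<Sum>k. ennreal (w k) * ennreal (de + (c (Suc k) - c k))) \<le>
      (\<Sum>k. ennreal (w k) * ennreal de + ennreal t * ennreal (c (Suc k) - c k))"
    using de incr w_le
    by (intro suminf_le)
      (auto simp: ennreal_plus distrib_left intro!: add_left_mono mult_right_mono ennreal_leI)
  also have "\<dots> = (\<Sum>k. ennreal (w k)) * ennreal de + ennreal t * (\<Sum>k. ennreal (c (Suc k) - c k))"
    by (subst suminf_add[symmetric]) (simp_all add: ennreal_suminf_multc ennreal_suminf_cmult)
  also have "\<dots> \<le> ennreal (1 / q) * ennreal de + ennreal t * ennreal chi"
    unfolding w_def suminf_discounted_annuity[OF q t]
    using c(2)[of 0] c(3)
    by (intro add_left_mono mult_left_mono suminf_ennreal_increments_le[OF c(1)])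
      (auto intro: order_trans[OF diff_left_mono])
  also have "\<dots> = ennreal (de / q + t * chi)"
    using q t de order_trans[OF c(2,3)] by (simp add: ennreal_mult'[symmetric] ennreal_plus)
  finally show ?thesis unfolding w_def .
qed

lemma mono_integral_ge_left_sum:
  fixes C :: "real \<Rightarrow> real"
  assumes mono: "mono_on {0..} C" and t: "0 < t" and D: "\<And>k. D k \<le> C (real k * t)"
  shows "t * (\<Sum>j<k. D j) \<le> integral {0..real k * t} C"
proof (induction k)
  case (Suc k)
  let ?I = "{real k * t..real (Suc k) * t}"
  have int: "C integrable_on {a..b}" if "0 \<le> a" for a b
    using that by (intro integrable_on_mono_on mono_on_subset[OF mono]) auto
  have "t * D k = integral ?I (\<lambda>_. D k)"
    using t by (simp add: algebra_simps)
  also have "\<dots> \<le> integral ?I C"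
  proof (rule integral_le)
    fix s assume s: "s \<in> ?I"
    have "C (real k * t) \<le> C s"
      using s t by (intro mono_onD[OF mono]) (auto intro: order_trans[rotated])
    then show "D k \<le> C s" using D[of k] by simp
  qed (use t in \<open>auto intro!: int integrable_const_ivl\<close>)
  finally have "t * (\<Sum>j<Suc k. D j) \<le> integral {0..real k * t} C + integral ?I C"
    using Suc.IH by (simp add: distrib_left)
  also have "\<dots> = integral {0..real (Suc k) * t} C"
    using t
    by (intro Henstock_Kurzweil_Integration.integral_combine int) (auto simp: mult_right_mono)
  finally show ?case .
qed simp

definition grid_surplus :: "real \<Rightarrow> (real \<Rightarrow> real) \<Rightarrow> (nat \<Rightarrow> real) \<Rightarrow> nat \<Rightarrow> real" where
  "grid_surplus t y D k = y (real k * t) - t * (\<Sum>j<k. D j)"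

definition survival :: "(nat \<Rightarrow> real) \<Rightarrow> nat \<Rightarrow> ennreal" where
  "survival X k = (\<Prod>j\<le>k. indicator {0..} (X j))"

lemma survival_eq_1: "(\<And>j. j \<le> k \<Longrightarrow> 0 \<le> X j) \<Longrightarrow> survival X k = 1"
  by (simp add: survival_def)

lemma survival_cases: "survival X k = 0 \<or> survival X k = 1 \<and> 0 \<le> X k"
proof (cases "\<forall>j\<le>k. 0 \<le> X j")
  case False
  then have "survival X k = 0" unfolding survival_def
    by (intro prod_zero) (auto simp: indicator_def)
  then show ?thesis ..
qed (simp add: survival_eq_1)

lemma survival_Suc: "survival X (Suc k) = survival X k * indicator {0..} (X (Suc k))"
  by (simp add: survival_def)

text \<open>Observing ruin only on the grid, and paying less, both delay ruin.\<close>

lemma grid_surplus_nonneg_before_ruin: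
  assumes mono: "mono_on {0..} C" and t: "0 < t" and D: "\<And>k. D k \<le> C (real k * t)"
    and s: "ereal s < path_ruin_time y C" and j: "real j * t \<le> s"
  shows "0 \<le> grid_surplus t y D j"
proof (rule ccontr)
  assume "\<not> ?thesis"
  moreover have "y (real j * t) - integral {0..real j * t} C \<le> grid_surplus t y D j"
    using mono_integral_ge_left_sum[OF mono t D, where k = j] by (simp add: grid_surplus_def)
  ultimately have "path_ruin_time y C \<le> ereal (real j * t)"
    unfolding path_ruin_time_def using t by (intro Inf_lower) (auto intro!: exI[of _ "real j * t"])
  also have "\<dots> \<le> ereal s" using j by simp
  finally show False using s by simp
qed

lemma grid_cell_exists:
  fixes s t :: real
  assumes "0 < t" "0 \<le> s"
  obtains k :: nat where "s \<in> {real k * t..real (Suc k) * t}"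
proof (rule that[of "nat \<lfloor>s / t\<rfloor>"])
  have "real (nat \<lfloor>s / t\<rfloor>) \<le> s / t" "s / t \<le> real (nat \<lfloor>s / t\<rfloor>) + 1"
    using assms by (auto simp: of_nat_nat)
  then show "s \<in> {real (nat \<lfloor>s / t\<rfloor>) * t..real (Suc (nat \<lfloor>s / t\<rfloor>)) * t}"
    using assms by (auto simp: divide_simps algebra_simps)
qed

lemma rate_le_grid_rate_before_ruin:
  assumes t: "0 < t" and de: "0 \<le> de" and mono: "mono_on {0..} C"
    and D: "\<And>k. D k \<le> C (real k * t)" "\<And>k. C (real k * t) \<le> D k + de" "\<And>k. 0 \<le> D k"
    and s: "ereal s < path_ruin_time y C"
    and k: "s \<in> {real k * t..real (Suc k) * t}"
  shows "ennreal (C s) \<le> survival (grid_surplus t y D) k * ennreal (D k) +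
    ennreal (de + (C (real (Suc k) * t) - C (real k * t)))"
proof -
  have "real j * t \<le> s" if "j \<le> k" for j
    using k that t order_trans[of "real j * t" "real k * t" s] by (auto simp: mult_right_mono)
  then have survival: "survival (grid_surplus t y D) k = 1"
    by (intro survival_eq_1 grid_surplus_nonneg_before_ruin[OF mono t D(1) s])
  have "0 \<le> real k * t" using t by simp
  then have "C (real k * t) \<le> C (real (Suc k) * t)" "C s \<le> C (real (Suc k) * t)"
    using k by (auto intro!: mono_onD[OF mono] simp del: of_nat_Suc)
  then have "0 \<le> de + (C (real (Suc k) * t) - C (real k * t))"
    and "C s \<le> D k + (de + (C (real (Suc k) * t) - C (real k * t)))"
    using de D(2)[of k] by linarith+
  then show ?thesis
    using D(3)[of k]
    by (simp add: survival ennreal_plus[symmetric] ennreal_leI del: ennreal_plus of_nat_Suc)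
qed

text \<open>The rewards lost by freezing the strategy between grid points telescope.\<close>

lemma path_payoff_le_grid:
  fixes C y :: "real \<Rightarrow> real" and D :: "nat \<Rightarrow> real"
  assumes q: "0 < q" and t: "0 < t" and de: "0 \<le> de"
    and mono: "mono_on {0..} C" and C: "\<And>s. 0 \<le> s \<Longrightarrow> 0 \<le> C s" "\<And>s. 0 \<le> s \<Longrightarrow> C s \<le> chi"
    and D: "\<And>k. D k \<le> C (real k * t)" "\<And>k. C (real k * t) \<le> D k + de" "\<And>k. 0 \<le> D k"
  shows "path_payoff q y C \<le>
    (\<Sum>k. ennreal (exp (- q * t) ^ k) *
      (survival (grid_surplus t y D) k * ennreal (annuity q t * D k))) +
    ennreal (de / q + t * chi)"
proof -
  define c where "c = (\<lambda>k :: nat. C (real k * t))"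
  define Z where "Z = survival (grid_surplus t y D)"
  define w where "w = (\<lambda>k. ennreal (exp (- q * t) ^ k * annuity q t))"
  define I where "I = (\<lambda>k :: nat. {real k * t..real (Suc k) * t})"
  define R where "R = (\<lambda>k. Z k * ennreal (D k) + ennreal (de + (c (Suc k) - c k)))"
  have c: "incseq c" "0 \<le> c k" "c k \<le> chi" for k
    using t C by (auto simp: c_def incseq_def mult_right_mono intro!: mono_onD[OF mono])
  have "indicator {s. 0 \<le> s \<and> ereal s < path_ruin_time y C} s * ennreal (exp (- q * s) * C s) \<le>
      (\<Sum>k. ennreal (exp (- q * s)) * indicator (I k) s * R k)" for s
  proof (cases "0 \<le> s \<and> ereal s < path_ruin_time y C")
    case True
    then obtain k where k: "s \<in> I k" using grid_cell_exists[OF t, of s] by (auto simp: I_def)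
    have "ennreal (C s) \<le> R k"
      using rate_le_grid_rate_before_ruin[OF t de mono D, of s y k] True k
      by (simp add: R_def Z_def c_def I_def)
    then have "ennreal (exp (- q * s) * C s) \<le> ennreal (exp (- q * s)) * indicator (I k) s * R k"
      using k by (simp add: ennreal_mult' mult_left_mono)
    also have "\<dots> \<le> (\<Sum>k. ennreal (exp (- q * s)) * indicator (I k) s * R k)"
      using sum_le_suminf[of "\<lambda>k. ennreal (exp (- q * s)) * indicator (I k) s * R k" "{k}"] by simp
    finally show ?thesis using True by simp
  qed simp
  then have "path_payoff q y C \<le>
      (\<integral>\<^sup>+ s. (\<Sum>k. ennreal (exp (- q * s)) * indicator (I k) s * R k) \<partial>lborel)"
    unfolding path_payoff_def by (rule nn_integral_mono)
  also have "\<dots> = (\<Sum>k. \<integral>\<^sup>+ s. ennreal (exp (- q * s)) * indicator (I k) s * R k \<partial>lborel)"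
    unfolding I_def by (intro nn_integral_suminf) measurable
  also have "\<dots> = (\<Sum>k. w k * R k)"
    unfolding I_def w_def nn_integral_exp_grid[OF q t, symmetric]
    by (intro suminf_cong nn_integral_multc) measurable
  also have "\<dots> = (\<Sum>k. w k * (Z k * ennreal (D k))) + (\<Sum>k. w k * ennreal (de + (c (Suc k) - c k)))"
    unfolding R_def distrib_left by (rule suminf_add[symmetric]) auto
  also have "\<dots> \<le> (\<Sum>k. w k * (Z k * ennreal (D k))) + ennreal (de / q + t * chi)"
    unfolding w_def by (intro add_left_mono discounted_freezing_error_le[OF q t de] c)
  also have "(\<lambda>k. w k * (Z k * ennreal (D k))) =
      (\<lambda>k. ennreal (exp (- q * t) ^ k) * (Z k * ennreal (annuity q t * D k)))"
    using D(3) q t annuity_nonneg[of q t] by (simp add: w_def ennreal_mult mult_ac)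
  finally show ?thesis unfolding Z_def .
qed

lemma discounted_supermartingale_sum_le:
  fixes a r :: "nat \<Rightarrow> ennreal" and b err :: real
  assumes b: "0 \<le> b" "b < 1" and err: "0 \<le> err"
    and step: "\<And>k. r k + ennreal b * a (Suc k) \<le> a k + ennreal err"
  shows "(\<Sum>k. ennreal (b ^ k) * r k) \<le> a 0 + ennreal (err / (1 - b))"
proof -
  have partial: "(\<Sum>k<n. ennreal (b ^ k) * r k) \<le> a 0 + ennreal (err * (\<Sum>k<n. b ^ k))" for n
    using step
  proof (induction n arbitrary: a r)
    case (Suc n)
    define S where "S = err * (\<Sum>k<n. b ^ k)"
    have S: "0 \<le> S" using b err by (simp add: S_def sum_nonneg)
    have "(\<Sum>k<Suc n. ennreal (b ^ k) * r k) = r 0 + ennreal b * (\<Sum>k<n. ennreal (b ^ k) * r (Suc k))"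
      using b
      by (simp add: sum.lessThan_Suc_shift sum_distrib_left ennreal_mult mult.assoc
        del: sum.lessThan_Suc)
    also have "\<dots> \<le> r 0 + ennreal b * (a (Suc 0) + ennreal S)"
      unfolding S_def
      by (intro add_left_mono mult_left_mono Suc.IH[of "\<lambda>k. r (Suc k)" "\<lambda>k. a (Suc k)"]
        Suc.prems) simp
    also have "\<dots> = (r 0 + ennreal b * a (Suc 0)) + ennreal (b * S)"
      using b S by (simp add: distrib_left ennreal_mult add.assoc)
    also have "\<dots> \<le> (a 0 + ennreal err) + ennreal (b * S)"
      by (intro add_right_mono Suc.prems)
    also have "\<dots> = a 0 + ennreal (err + b * S)"
      using b err S by (simp add: ennreal_plus add.assoc)
    also have "err + b * S = err * (\<Sum>k<Suc n. b ^ k)"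
      by (simp add: S_def sum.lessThan_Suc_shift sum_distrib_left algebra_simps del: sum.lessThan_Suc)
    finally show ?case .
  qed simp
  have "(\<Sum>k<n. ennreal (b ^ k) * r k) \<le> a 0 + ennreal (err / (1 - b))" for n
  proof -
    have "(\<Sum>k<n. b ^ k) \<le> 1 / (1 - b)" using b by (simp add: sum_gp_strict divide_right_mono)
    then have "err * (\<Sum>k<n. b ^ k) \<le> err / (1 - b)"
      using mult_left_mono[of _ "1 / (1 - b)" err] err by simp
    then show ?thesis by (intro order_trans[OF partial] add_left_mono ennreal_leI)
  qed
  then show ?thesis unfolding suminf_eq_SUP by (intro SUP_least)
qed

section \<open>Strategies frozen on a time grid\<close>

locale frozen_strategy = brownian_motion M B
  for M :: "'a measure" and B :: "real \<Rightarrow> 'a \<Rightarrow> real" +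
  fixes mu sig q clo chi x c t de :: real and C :: "real \<Rightarrow> 'a \<Rightarrow> real"
  assumes admissible: "C \<in> admissible M mu sig B {clo..chi} x c"
    and discount_pos: "0 < q" and step_pos: "0 < t" and margin: "0 < de" "c \<le> chi - de"
    and rates_nonneg: "0 \<le> clo" "clo \<le> c"
begin

text \<open>The margin \<open>de\<close> keeps the rates below \<open>chi\<close>, where nothing is known about the supersolution.\<close>

definition rate :: "nat \<Rightarrow> 'a \<Rightarrow> real" where
  "rate k \<omega> = min (C (real k * t) \<omega>) (chi - de)"

definition frozen_surplus :: "nat \<Rightarrow> 'a \<Rightarrow> real" where
  "frozen_surplus k \<omega> = grid_surplus t (\<lambda>s. Xproc mu sig B x s \<omega>) (\<lambda>j. rate j \<omega>) k"

definition alive :: "nat \<Rightarrow> 'a \<Rightarrow> ennreal" where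
  "alive k \<omega> = survival (\<lambda>j. frozen_surplus j \<omega>) k"

abbreviation grid_filt :: "nat \<Rightarrow> 'a measure" where
  "grid_filt k \<equiv> filt M (Xproc mu sig B x) (real k * t)"

lemma grid_time_nonneg: "0 \<le> real k * t"
  using step_pos by simp

lemma grid_time_mono: "j \<le> k \<Longrightarrow> real j * t \<le> real k * t"
  using step_pos by (simp add: mult_right_mono)

lemma strategy_mono: "\<omega> \<in> space M \<Longrightarrow> mono_on {0..} (\<lambda>s. C s \<omega>)"
  and strategy_bounds: "\<omega> \<in> space M \<Longrightarrow> 0 \<le> s \<Longrightarrow> c \<le> C s \<omega>" "\<omega> \<in> space M \<Longrightarrow> 0 \<le> s \<Longrightarrow> C s \<omega> \<le> chi"
  using admissible by (auto simp: admissible_def)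

lemma rate_bounds:
  assumes "\<omega> \<in> space M"
  shows "c \<le> rate k \<omega>" "rate k \<omega> < chi"
    "rate k \<omega> \<le> C (real k * t) \<omega>" "C (real k * t) \<omega> \<le> rate k \<omega> + de"
  using strategy_bounds[OF assms grid_time_nonneg[of k]] margin by (auto simp: rate_def)

lemma rate_mono:
  assumes "\<omega> \<in> space M"
  shows "rate k \<omega> \<le> rate (Suc k) \<omega>"
proof -
  have "C (real k * t) \<omega> \<le> C (real (Suc k) * t) \<omega>"
    using grid_time_nonneg grid_time_mono
    by (intro mono_onD[OF strategy_mono[OF assms]]) (auto simp del: of_nat_Suc)
  then show ?thesis unfolding rate_def by (intro min.mono) auto
qed

lemma rate_measurable:
  assumes "j \<le> k"
  shows "rate j \<in> borel_measurable (grid_filt k)"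
proof -
  have "C (real j * t) \<in> borel_measurable (grid_filt j)"
    using admissible grid_time_nonneg by (auto simp: admissible_def)
  then have [measurable]: "C (real j * t) \<in> borel_measurable (grid_filt k)"
    by (rule measurable_filt_mono[OF grid_time_mono[OF assms]])
  then show ?thesis unfolding rate_def by measurable
qed

lemma frozen_surplus_measurable:
  assumes "j \<le> k"
  shows "frozen_surplus j \<in> borel_measurable (grid_filt k)"
proof -
  have "Xproc mu sig B x (real j * t) \<in> borel_measurable (grid_filt k)"
    by (rule measurable_filt_process[OF grid_time_nonneg grid_time_mono[OF assms]])
  moreover have "(\<lambda>\<omega>. t * (\<Sum>i<j. rate i \<omega>)) \<in> borel_measurable (grid_filt k)"
    using assms
    by (intro borel_measurable_times borel_measurable_const borel_measurable_sum rate_measurable) auto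
  ultimately show ?thesis
    unfolding frozen_surplus_def grid_surplus_def by (rule borel_measurable_diff)
qed

lemma alive_measurable: "alive k \<in> borel_measurable (grid_filt k)"
  unfolding alive_def survival_def
  by (intro borel_measurable_prod_ennreal measurable_compose[OF frozen_surplus_measurable]
    borel_measurable_indicator) auto

lemmas measurable_completion_frozen [measurable] =
  measurable_filt_completion[OF grid_time_nonneg rate_measurable[OF order_refl]]
  measurable_filt_completion[OF grid_time_nonneg frozen_surplus_measurable[OF order_refl]]
  measurable_filt_completion[OF grid_time_nonneg alive_measurable]

lemma frozen_surplus_0: "\<omega> \<in> space M \<Longrightarrow> frozen_surplus 0 \<omega> = x"
  by (simp add: frozen_surplus_def grid_surplus_def Xproc_def B_0)

lemma frozen_surplus_Suc:
  "frozen_surplus (Suc k) \<omega> =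
    frozen_surplus k \<omega> + ((mu - rate k \<omega>) * t + sig * increment (real k * t) t \<omega>)"
  by (simp add: frozen_surplus_def grid_surplus_def Xproc_def algebra_simps)

definition reward :: "nat \<Rightarrow> ennreal" where
  "reward k = (\<integral>\<^sup>+ \<omega>. alive k \<omega> * ennreal (annuity q t * rate k \<omega>) \<partial>completion M)"

lemma expected_payoff_le_rewards:
  "(\<integral>\<^sup>+ \<omega>. path_payoff q (\<lambda>s. Xproc mu sig B x s \<omega>) (\<lambda>s. C s \<omega>) \<partial>M) \<le>
    (\<Sum>k. ennreal (exp (- q * t) ^ k) * reward k) + ennreal (de / q + t * chi)"
proof -
  define R where "R = (\<lambda>k \<omega>. alive k \<omega> * ennreal (annuity q t * rate k \<omega>))"
  have [measurable]: "R k \<in> borel_measurable (completion M)" for k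
    unfolding R_def by measurable
  have "path_payoff q (\<lambda>s. Xproc mu sig B x s \<omega>) (\<lambda>s. C s \<omega>) \<le>
      (\<Sum>k. ennreal (exp (- q * t) ^ k) * R k \<omega>) + ennreal (de / q + t * chi)"
    if \<omega>: "\<omega> \<in> space M" for \<omega>
    unfolding R_def alive_def frozen_surplus_def
  proof (rule path_payoff_le_grid[OF discount_pos step_pos])
    show "mono_on {0..} (\<lambda>s. C s \<omega>)" by (rule strategy_mono[OF \<omega>])
    show "0 \<le> rate k \<omega>" for k using rate_bounds(1)[OF \<omega>, of k] rates_nonneg by simp
    show "0 \<le> C s \<omega>" "C s \<omega> \<le> chi" if "0 \<le> s" for s
      using strategy_bounds[OF \<omega> that] rates_nonneg by simp_all
  qed (use margin rate_bounds[OF \<omega>] in auto)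
  then have "(\<integral>\<^sup>+ \<omega>. path_payoff q (\<lambda>s. Xproc mu sig B x s \<omega>) (\<lambda>s. C s \<omega>) \<partial>M) \<le>
      (\<integral>\<^sup>+ \<omega>. (\<Sum>k. ennreal (exp (- q * t) ^ k) * R k \<omega>) + ennreal (de / q + t * chi) \<partial>M)"
    by (rule nn_integral_mono)
  also have "\<dots> =
      (\<integral>\<^sup>+ \<omega>. (\<Sum>k. ennreal (exp (- q * t) ^ k) * R k \<omega>) + ennreal (de / q + t * chi) \<partial>completion M)"
    by (rule nn_integral_completion[symmetric])
  also have "\<dots> =
      (\<Sum>k. \<integral>\<^sup>+ \<omega>. ennreal (exp (- q * t) ^ k) * R k \<omega> \<partial>completion M) + ennreal (de / q + t * chi)"
    using completed.emeasure_space_1 by (subst nn_integral_add) (simp_all add: nn_integral_suminf)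
  also have "\<dots> = (\<Sum>k. ennreal (exp (- q * t) ^ k) * reward k) + ennreal (de / q + t * chi)"
    by (simp add: nn_integral_cmult) (simp add: reward_def R_def)
  finally show ?thesis .
qed

end

section \<open>Verification\<close>

context bounded_supersolution
begin

lemma killed_shift_measurable:
  assumes "0 \<le> eps"
  shows "killed_shift eps \<in> borel_measurable borel"
  unfolding killed_shift_def
proof (rule borel_measurable_continuous_on_if)
  show "states \<in> sets borel" by (simp add: borel_Times)
  show "continuous_on states (\<lambda>p. W (fst p + eps, snd p))"
    using assms by (intro continuous_on_compose2[OF continuous_on_states] continuous_intros) auto
qed simp

lemma killed_shift_antimono_rate:
  assumes "0 < eps" "clo \<le> d" "d \<le> d'" "d' < chi"
  shows "killed_shift eps (x, d') \<le> killed_shift eps (x, d)"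
  using assms antimono_rate[of "x + eps" d d'] by (auto simp: killed_shift_def)

end

locale frozen_verification =
  bounded_supersolution mu sig q clo chi W + frozen_strategy M B mu sig q clo chi x c t de C
  for mu sig q clo chi :: real and W and M :: "'a measure" and B x c t de C +
  fixes eps err :: real
  assumes eps_pos: "0 < eps" and err_nonneg: "0 \<le> err" and x_nonneg: "0 \<le> x"
    and one_step: "0 \<le> y \<Longrightarrow> clo \<le> d \<Longrightarrow> d < chi \<Longrightarrow>
      ennreal (d * annuity q t) +
        ennreal (exp (- q * t)) * surplus_transition mu sig t (killed_value eps) (y, d)
      \<le> killed_value eps (y, d) + ennreal err"
begin

definition continuation :: "nat \<Rightarrow> ennreal" where
  "continuation k =
    (\<integral>\<^sup>+ \<omega>. alive k \<omega> * killed_value eps (frozen_surplus k \<omega>, rate k \<omega>) \<partial>completion M)"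

lemma killed_value_measurable [measurable]: "killed_value eps \<in> borel_measurable borel"
  using killed_shift_measurable eps_pos by simp

lemma continuation_Suc_le:
  "continuation (Suc k) \<le> (\<integral>\<^sup>+ \<omega>. alive k \<omega> *
    surplus_transition mu sig t (killed_value eps) (frozen_surplus k \<omega>, rate k \<omega>) \<partial>completion M)"
proof -
  have "continuation (Suc k) \<le> (\<integral>\<^sup>+ \<omega>. alive k \<omega> * killed_value eps
      (frozen_surplus k \<omega> + ((mu - rate k \<omega>) * t + sig * increment (real k * t) t \<omega>), rate k \<omega>)
      \<partial>completion M)"
    unfolding continuation_def frozen_surplus_Suc[symmetric]
  proof (rule nn_integral_mono)
    fix \<omega> assume "\<omega> \<in> space (completion M)"
    then have \<omega>: "\<omega> \<in> space M" by simp
    have "alive (Suc k) \<omega> \<le> alive k \<omega>"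
      by (simp add: alive_def survival_Suc indicator_def)
    moreover have "killed_shift eps (frozen_surplus (Suc k) \<omega>, rate (Suc k) \<omega>) \<le>
        killed_shift eps (frozen_surplus (Suc k) \<omega>, rate k \<omega>)"
      using rate_bounds[OF \<omega>, of k] rate_bounds[OF \<omega>, of "Suc k"] rates_nonneg eps_pos
      by (intro killed_shift_antimono_rate rate_mono[OF \<omega>]) auto
    ultimately show "alive (Suc k) \<omega> * killed_value eps (frozen_surplus (Suc k) \<omega>, rate (Suc k) \<omega>) \<le>
        alive k \<omega> * killed_value eps (frozen_surplus (Suc k) \<omega>, rate k \<omega>)"
      by (intro mult_mono ennreal_leI) auto
  qed
  also have "\<dots> = (\<integral>\<^sup>+ \<omega>. alive k \<omega> *
      surplus_transition mu sig t (killed_value eps) (frozen_surplus k \<omega>, rate k \<omega>) \<partial>completion M)"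
    by (intro nn_integral_surplus_transition[OF grid_time_nonneg step_pos alive_measurable
          frozen_surplus_measurable[OF order_refl] rate_measurable[OF order_refl]]) measurable
  finally show ?thesis .
qed

lemma surplus_transition_frozen_measurable [measurable]:
  "(\<lambda>\<omega>. surplus_transition mu sig t (killed_value eps) (frozen_surplus k \<omega>, rate k \<omega>))
    \<in> borel_measurable (completion M)"
  unfolding surplus_transition_def case_prod_conv
proof (rule sigma_finite_measure.borel_measurable_nn_integral)
  show "sigma_finite_measure (centred_gaussian t)"
    using prob_space_centred_gaussian[OF step_pos] by (rule prob_space_imp_sigma_finite)
qed measurable

lemma reward_continuation_step:
  "reward k + ennreal (exp (- q * t)) * continuation (Suc k) \<le> continuation k + ennreal err"
proof -
  let ?T = "\<lambda>\<omega>. surplus_transition mu sig t (killed_value eps) (frozen_surplus k \<omega>, rate k \<omega>)"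
  have "reward k + ennreal (exp (- q * t)) * continuation (Suc k) \<le>
      reward k + ennreal (exp (- q * t)) * (\<integral>\<^sup>+ \<omega>. alive k \<omega> * ?T \<omega> \<partial>completion M)"
    by (intro add_left_mono mult_left_mono continuation_Suc_le) simp
  also have "\<dots> = (\<integral>\<^sup>+ \<omega>. alive k \<omega> *
      (ennreal (rate k \<omega> * annuity q t) + ennreal (exp (- q * t)) * ?T \<omega>) \<partial>completion M)"
    by (simp add: reward_def nn_integral_cmult[symmetric] nn_integral_add[symmetric]
      distrib_left mult_ac)
  also have "\<dots> \<le> (\<integral>\<^sup>+ \<omega>. alive k \<omega> * killed_value eps (frozen_surplus k \<omega>, rate k \<omega>) +
      ennreal err \<partial>completion M)"
  proof (rule nn_integral_mono)
    fix \<omega> assume "\<omega> \<in> space (completion M)"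
    then have \<omega>: "\<omega> \<in> space M" by simp
    consider (ruined) "alive k \<omega> = 0" | (solvent) "alive k \<omega> = 1" "0 \<le> frozen_surplus k \<omega>"
      using survival_cases[of "\<lambda>j. frozen_surplus j \<omega>" k] by (auto simp: alive_def)
    then show "alive k \<omega> * (ennreal (rate k \<omega> * annuity q t) + ennreal (exp (- q * t)) * ?T \<omega>) \<le>
        alive k \<omega> * killed_value eps (frozen_surplus k \<omega>, rate k \<omega>) + ennreal err"
    proof cases
      case solvent
      then show ?thesis
        using one_step[of "frozen_surplus k \<omega>" "rate k \<omega>"] rate_bounds[OF \<omega>, of k] rates_nonneg
        by simp
    qed simp
  qed
  also have "\<dots> = continuation k + ennreal err"
    using completed.emeasure_space_1 by (subst nn_integral_add) (simp_all add: continuation_def)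
  finally show ?thesis .
qed

lemma continuation_0_le: "continuation 0 \<le> ennreal (W (x + eps, c))"
proof -
  have "continuation 0 \<le> (\<integral>\<^sup>+ \<omega>. ennreal (W (x + eps, c)) \<partial>completion M)"
    unfolding continuation_def
  proof (rule nn_integral_mono)
    fix \<omega> assume "\<omega> \<in> space (completion M)"
    then have \<omega>: "\<omega> \<in> space M" by simp
    have "alive 0 \<omega> = 1"
      using x_nonneg by (simp add: alive_def survival_def frozen_surplus_0[OF \<omega>])
    moreover have "killed_shift eps (x, rate 0 \<omega>) \<le> killed_shift eps (x, c)"
      using rate_bounds[OF \<omega>, of 0] rates_nonneg eps_pos by (intro killed_shift_antimono_rate) auto
    moreover have "killed_shift eps (x, c) = W (x + eps, c)"
      using x_nonneg rates_nonneg margin by (simp add: killed_shift_def)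
    ultimately show
      "alive 0 \<omega> * killed_value eps (frozen_surplus 0 \<omega>, rate 0 \<omega>) \<le> ennreal (W (x + eps, c))"
      by (simp add: frozen_surplus_0[OF \<omega>] ennreal_leI)
  qed
  then show ?thesis using completed.emeasure_space_1 by simp
qed

lemma Jval_le_shifted:
  "Jval M mu sig q B x C \<le> W (x + eps, c) + err / (1 - exp (- q * t)) + (de / q + t * chi)"
proof -
  have "0 \<le> W (x + eps, c)" using nonneg x_nonneg eps_pos rates_nonneg margin by simp
  moreover have "0 \<le> chi" using rates_nonneg margin by simp
  ultimately have bounds: "0 \<le> W (x + eps, c)" "0 \<le> err / (1 - exp (- q * t))" "0 \<le> de / q + t * chi"
    using err_nonneg discount_pos step_pos margin by simp_all
  have "(\<Sum>k. ennreal (exp (- q * t) ^ k) * reward k) \<le>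
      continuation 0 + ennreal (err / (1 - exp (- q * t)))"
    using discount_pos step_pos
    by (intro discounted_supermartingale_sum_le reward_continuation_step err_nonneg) auto
  also have "\<dots> \<le> ennreal (W (x + eps, c)) + ennreal (err / (1 - exp (- q * t)))"
    by (intro add_right_mono continuation_0_le)
  finally have "(\<integral>\<^sup>+ \<omega>. path_payoff q (\<lambda>s. Xproc mu sig B x s \<omega>) (\<lambda>s. C s \<omega>) \<partial>M) \<le>
      ennreal (W (x + eps, c)) + ennreal (err / (1 - exp (- q * t))) + ennreal (de / q + t * chi)"
    by (intro order_trans[OF expected_payoff_le_rewards] add_right_mono)
  also have "\<dots> = ennreal (W (x + eps, c) + err / (1 - exp (- q * t)) + (de / q + t * chi))"
    using bounds by (simp add: ennreal_plus)
  finally show ?thesis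
    unfolding Jval_eq_path_payoff using bounds by (intro enn2real_leI) auto
qed

end

context bounded_supersolution
begin

lemma Jval_le_shift:
  assumes BM: "std_BM M B" and x: "0 \<le> x" and c: "clo \<le> c" "c < chi"
    and C: "C \<in> admissible M mu sig B {clo..chi} x c" and eps: "0 < eps"
  shows "Jval M mu sig q B x C \<le> W (x + eps, c)"
proof -
  obtain K where K: "0 \<le> K"
    and one_step: "\<And>y d t. 0 \<le> y \<Longrightarrow> clo \<le> d \<Longrightarrow> d < chi \<Longrightarrow> 0 < t \<Longrightarrow> t \<le> 1 \<Longrightarrow>
      ennreal (d * annuity q t) +
        ennreal (exp (- q * t)) * surplus_transition mu sig t (killed_value eps) (y, d)
      \<le> killed_value eps (y, d) + ennreal (K * exp (- eps / sqrt t))"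
    using discounted_one_step[OF eps] by blast
  define bound where "bound = (\<lambda>t. W (x + eps, c) +
    K * (exp (- eps / sqrt t) / (1 - exp (- q * t))) + (t / q + t * chi))"
  have "Jval M mu sig q B x C \<le> bound t" if t: "0 < t" "t < min 1 (chi - c)" for t
  proof -
    interpret frozen_verification mu sig q clo chi W M B x c t t C eps "K * exp (- eps / sqrt t)"
      by unfold_locales (use BM x c C eps K one_step t q_pos clo_nonneg in auto)
    show ?thesis using Jval_le_shifted by (simp add: bound_def)
  qed
  then have "\<forall>\<^sub>F t in at_right 0. Jval M mu sig q B x C \<le> bound t"
    using c by (intro eventually_at_rightI[of 0 "min 1 (chi - c)"]) auto
  moreover have "(bound \<longlongrightarrow> W (x + eps, c)) (at_right 0)"
  proof -
    have "((\<lambda>t. exp (- eps / sqrt t) / (1 - exp (- q * t))) \<longlongrightarrow> 0) (at_right 0)"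
      using eps q_pos by real_asymp
    then have "(bound \<longlongrightarrow> W (x + eps, c) + K * 0 + (0 / q + 0 * chi)) (at_right 0)"
      unfolding bound_def using q_pos by (intro tendsto_intros) auto
    then show ?thesis by simp
  qed
  ultimately show ?thesis by (intro tendsto_lowerbound[of bound]) auto
qed

theorem Jval_le_supersolution:
  assumes BM: "std_BM M B" and x: "0 \<le> x" and c: "clo \<le> c" "c < chi"
    and C: "C \<in> admissible M mu sig B {clo..chi} x c"
  shows "Jval M mu sig q B x C \<le> W (x, c)"
proof (rule tendsto_lowerbound)
  have "((\<lambda>y. W (y, c)) \<longlongrightarrow> W (x, c)) (at x within {0..})"
    using continuous_on_section(1)[OF c] x by (simp add: continuous_on_def)
  then show "((\<lambda>y. W (y, c)) \<longlongrightarrow> W (x, c)) (at_right x)"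
    by (rule tendsto_within_subset) (use x in auto)
  show "\<forall>\<^sub>F y in at_right x. Jval M mu sig q B x C \<le> W (y, c)"
    using eventually_at_right_less[of x]
  proof eventually_elim
    case (elim y)
    then show ?case using Jval_le_shift[OF BM x c C, of "y - x"] by simp
  qed
qed simp

end

lemma Jval_bounds:
  assumes BM: "std_BM M B" and q: "0 < q" and chi: "0 \<le> chi"
    and C: "C \<in> admissible M mu sig B {clo..chi} x c"
  shows "0 \<le> Jval M mu sig q B x C" "Jval M mu sig q B x C \<le> chi / q"
proof -
  interpret brownian_motion M B by unfold_locales (rule BM)
  show "0 \<le> Jval M mu sig q B x C" by (simp add: Jval_def)
  have "(\<integral>\<^sup>+ \<omega>. path_payoff q (\<lambda>t. Xproc mu sig B x t \<omega>) (\<lambda>t. C t \<omega>) \<partial>M) \<le>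
      (\<integral>\<^sup>+ \<omega>. ennreal (chi / q) \<partial>M)"
    using C q chi by (intro nn_integral_mono path_payoff_le) (auto simp: admissible_def)
  then show "Jval M mu sig q B x C \<le> chi / q"
    unfolding Jval_eq_path_payoff using q chi by (intro enn2real_leI) (auto simp: emeasure_space_1)
qed

lemma Jval_cong:
  assumes "\<And>\<omega> s. \<omega> \<in> space M \<Longrightarrow> 0 \<le> s \<Longrightarrow> C s \<omega> = C' s \<omega>"
  shows "Jval M mu sig q B x C = Jval M mu sig q B x C'"
proof -
  have "integral {0..t} (\<lambda>s. C s \<omega>) = integral {0..t} (\<lambda>s. C' s \<omega>)" if "\<omega> \<in> space M" for t \<omega>
    using assms[OF that] by (intro Henstock_Kurzweil_Integration.integral_cong) auto
  then show ?thesis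
    unfolding Jval_eq_path_payoff path_payoff_def path_ruin_time_def using assms
    by (intro arg_cong[where f = enn2real] nn_integral_cong) (auto simp: indicator_def)
qed

lemma Jval_eq_if_admissible_max:
  assumes "C \<in> admissible M mu sig B {clo..chi} x chi" "C' \<in> admissible M mu sig B {clo..chi} x chi"
  shows "Jval M mu sig q B x C = Jval M mu sig q B x C'"
proof (rule Jval_cong)
  fix \<omega> s assume "\<omega> \<in> space M" "(0::real) \<le> s"
  then have "C s \<omega> = chi" "C' s \<omega> = chi"
    using assms by (auto simp: admissible_def intro!: antisym)
  then show "C s \<omega> = C' s \<omega>" by simp
qed

lemma Jval_le_Vval:
  assumes "std_BM M B" "0 < q" "0 \<le> chi" and C: "C \<in> admissible M mu sig B {clo..chi} x c"
  shows "Jval M mu sig q B x C \<le> Vval M mu sig q B {clo..chi} x c"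
  unfolding Vval_def using Jval_bounds(2)[OF assms(1-3)] C by (intro cSUP_upper bdd_aboveI2)

theorem visc_super_limit_eq_Vval:
  fixes B :: "real \<Rightarrow> 'a \<Rightarrow> real" and Ck :: "nat \<Rightarrow> real \<Rightarrow> real \<Rightarrow> real \<Rightarrow> 'a \<Rightarrow> real"
  assumes BM: "std_BM M B" and sig: "0 < sig" and q: "0 < q" and clo: "0 \<le> clo" "clo < chi"
    and super: "visc_super mu sig q clo chi W"
    and adm: "\<And>k x c. 1 \<le> k \<Longrightarrow> 0 \<le> x \<Longrightarrow> c \<in> {clo..chi} \<Longrightarrow>
      Ck k x c \<in> admissible M mu sig B {clo..chi} x c"
    and lim: "\<And>x c. 0 \<le> x \<Longrightarrow> c \<in> {clo..chi} \<Longrightarrow> (\<lambda>k. Jval M mu sig q B x (Ck k x c)) \<longlonglongrightarrow> W (x, c)"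
    and x: "0 \<le> x" and c: "c \<in> {clo..chi}"
  shows "W (x, c) = Vval M mu sig q B {clo..chi} x c"
proof (rule antisym)
  have chi: "0 \<le> chi" using clo by simp
  have W_le: "W (y, d) \<le> u"
    if "0 \<le> y" "d \<in> {clo..chi}" "\<And>k. 1 \<le> k \<Longrightarrow> Jval M mu sig q B y (Ck k y d) \<le> u" for y d u
    using that(3)
    by (intro tendsto_upperbound[OF lim[OF that(1,2)]] eventually_sequentiallyI[of 1]) auto
  have W_ge: "l \<le> W (y, d)"
    if "0 \<le> y" "d \<in> {clo..chi}" "\<And>k. 1 \<le> k \<Longrightarrow> l \<le> Jval M mu sig q B y (Ck k y d)" for y d l
    using that(3)
    by (intro tendsto_lowerbound[OF lim[OF that(1,2)]] eventually_sequentiallyI[of 1]) auto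
  interpret bounded_supersolution mu sig q clo chi W
    by unfold_locales (use super sig q clo Jval_bounds[OF BM q chi adm] in \<open>auto intro!: W_le W_ge\<close>)
  show "W (x, c) \<le> Vval M mu sig q B {clo..chi} x c"
    by (intro W_le x c Jval_le_Vval[OF BM q chi] adm)
  show "Vval M mu sig q B {clo..chi} x c \<le> W (x, c)"
    unfolding Vval_def
  proof (rule cSUP_least)
    show "admissible M mu sig B {clo..chi} x c \<noteq> {}" using adm[OF order_refl x c] by blast
    fix C assume C: "C \<in> admissible M mu sig B {clo..chi} x c"
    consider (below_max) "c < chi" | (at_max) "c = chi" using c by force
    then show "Jval M mu sig q B x C \<le> W (x, c)"
    proof cases
      case below_max
      then show ?thesis using Jval_le_supersolution[OF BM x _ _ C] c by simp
    next
      case at_max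
      then have "Jval M mu sig q B x C \<le> Jval M mu sig q B x (Ck k x c)" if "1 \<le> k" for k
        using Jval_eq_if_admissible_max C adm[OF that x c] by (metis order_refl)
      then show ?thesis by (intro W_ge x c)
    qed
  qed
qed

theorem mainTheorem7:
  fixes M :: "'a measure" and B :: "real \<Rightarrow> 'a \<Rightarrow> real"
    and mu sig q clo chi :: real
  assumes "std_BM M B" and "0 < mu" and "0 < sig" and "0 < q"
    and "0 \<le> clo" and "clo < chi"
  shows "(\<forall>Cf :: real \<Rightarrow> real \<Rightarrow> (real \<Rightarrow> 'a \<Rightarrow> real).
            (\<forall>x\<ge>0. \<forall>c\<in>{clo..chi}. Cf x c \<in> admissible M mu sig B {clo..chi} x c) \<and>
            visc_super mu sig q clo chi (\<lambda>(x, c). Jval M mu sig q B x (Cf x c)) \<and>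
            (\<forall>c\<in>{clo..chi}. Jval M mu sig q B 0 (Cf 0 c) = 0) \<and>
            (\<forall>c\<in>{clo..chi}. ((\<lambda>x. Jval M mu sig q B x (Cf x c)) \<longlongrightarrow> chi / q) at_top)
            \<longrightarrow> (\<forall>x\<ge>0. \<forall>c\<in>{clo..chi}.
                  Jval M mu sig q B x (Cf x c) = Vval M mu sig q B {clo..chi} x c))
       \<and> (\<forall>(Ck :: nat \<Rightarrow> real \<Rightarrow> real \<Rightarrow> (real \<Rightarrow> 'a \<Rightarrow> real)) (W :: real \<times> real \<Rightarrow> real).
            (\<forall>k\<ge>1. \<forall>x\<ge>0. \<forall>c\<in>{clo..chi}. Ck k x c \<in> admissible M mu sig B {clo..chi} x c) \<and>
            (\<forall>x\<ge>0. \<forall>c\<in>{clo..chi}.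
               ((\<lambda>k. Jval M mu sig q B x (Ck k x c)) \<longlongrightarrow> W (x, c)) sequentially) \<and>
            visc_super mu sig q clo chi W \<and>
            (\<forall>c\<in>{clo..chi}. W (0, c) = 0) \<and>
            (\<forall>c\<in>{clo..chi}. ((\<lambda>x. W (x, c)) \<longlongrightarrow> chi / q) at_top)
            \<longrightarrow> (\<forall>x\<ge>0. \<forall>c\<in>{clo..chi}. W (x, c) = Vval M mu sig q B {clo..chi} x c))"
proof (intro conjI allI ballI impI; elim conjE)
  note limit_eq_Vval = visc_super_limit_eq_Vval[OF assms(1,3-6)]
  fix x c :: real assume x: "0 \<le> x" and c: "c \<in> {clo..chi}"
  show "Jval M mu sig q B x (Cf x c) = Vval M mu sig q B {clo..chi} x c"
    if "\<forall>x\<ge>0. \<forall>c\<in>{clo..chi}. Cf x c \<in> admissible M mu sig B {clo..chi} x c"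
      "visc_super mu sig q clo chi (\<lambda>(x, c). Jval M mu sig q B x (Cf x c))" for Cf
    using limit_eq_Vval[OF that(2), of "\<lambda>_. Cf" x c] that(1) x c by simp
  show "W (x, c) = Vval M mu sig q B {clo..chi} x c"
    if "\<forall>k\<ge>1. \<forall>x\<ge>0. \<forall>c\<in>{clo..chi}. Ck k x c \<in> admissible M mu sig B {clo..chi} x c"
      "\<forall>x\<ge>0. \<forall>c\<in>{clo..chi}. ((\<lambda>k. Jval M mu sig q B x (Ck k x c)) \<longlongrightarrow> W (x, c)) sequentially"
      "visc_super mu sig q clo chi W" for Ck W
    using limit_eq_Vval[OF that(3), of Ck x c] that(1,2) x c by simp
qed

end
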